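(* Let $\beta>0$. Let $m\to\infty$ and let $n=n_m\to\infty$, $s=s_m$, $P=P_m$ depend on $m$. Assume that $s=O(1)$ and $\binom ms n^{-1}\to\beta$ as $m\to\infty$. Let $X_1$ have distribution $P$ and let $Z_{m1}=\binom{X_1}{s}\binom ms^{-1/2}n^{1/2}$. Assume that there is a random variable $Z$ such that $Z_{m1}$ converges in distribution to $Z$, $0<\mathbf E Z^2<\infty$, and $\lim_{m\to\infty}\mathbf E Z_{m1}^2=\mathbf E Z^2$. Let $\mu=\mathbf E Z$ and let $d_*$ be a random variable with distribution $$\mathbf P(d_*=k)=\frac1{k!}\,\mathbf E\bigl((Z\mu)^k e^{-Z\mu}\bigr),\qquad k=0,1,2,\dots.$$ Then the clustering coefficient of the active random intersection graph $G_s(n,m,P)$ satisfies, as $m\to\infty$, $$\alpha_s(m,P)=\frac1{\sqrt\beta}\,\frac{(\mathbf E d_* )^{3/2}}{\mathbf E d_*^2-\mathbf E d_*}+o(1).$$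
   Context: Active random intersection graph $G_s(n,m,P)$: let $W=\{w_1,\dots,w_m\}$, let $P$ be a probability distribution on $\{0,1,\dots,m\}$, and let $1\le s\le m$ be an integer. Let $D_1,\dots,D_n$ be independent identically distributed random subsets of $W$ with $\mathbf P(D_i=A)=P(|A|)\binom{m}{|A|}^{-1}$ for each $A\subset W$. The vertex set is $\{v_1,\dots,v_n\}$, and distinct vertices $v_i,v_j$ are adjacent ($v_i\sim v_j$) iff $|D_i\cap D_j|\ge s$. As usual $\binom{x}{s}=0$ for integers $0\le x<s$. Clustering coefficient: $\alpha_s(m,P)=\mathbf P(v_2\sim v_3\mid v_1\sim v_2,\ v_1\sim v_3)$; it does not depend on $n\ge3$ nor on the choice of the three distinct vertices. *)

theory Defs
  imports "HOL-Probability.Probability" "HOL-Library.Landau_Symbols"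
begin

text \<open>
  The attribute set \<open>W\<close> is \<open>{1..m}\<close> and the vertex set is \<open>{1..n}\<close>. A distribution on
  \<open>{0,\<dots>,m}\<close> is a \<open>nat pmf\<close> whose support is contained in \<open>{0..m}\<close>; under this condition the
  weights below sum to 1 (see \<open>pmf_random_subset\<close>).
\<close>

definition random_subset :: "nat \<Rightarrow> nat pmf \<Rightarrow> nat set pmf" where
  "random_subset m P =
     embed_pmf (\<lambda>A. if A \<subseteq> {1..m} then pmf P (card A) / real (m choose card A) else 0)"

lemma pmf_random_subset:
  assumes "set_pmf P \<subseteq> {0..m}"
  shows "pmf (random_subset m P) A =
           (if A \<subseteq> {1..m} then pmf P (card A) / real (m choose card A) else 0)"
proof -
  define Q where "Q = bind_pmf P (\<lambda>k. pmf_of_set {A. A \<subseteq> {1..m} \<and> card A = k})"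
  have Q: "pmf Q A = (if A \<subseteq> {1..m} then pmf P (card A) / real (m choose card A) else 0)" for A
  proof -
    let ?S = "\<lambda>k. {A. A \<subseteq> {1..m} \<and> card A = k}"
    have fin: "finite (?S k)" for k
      by (rule finite_subset[of _ "Pow {1..m}"]) auto
    have cd: "card (?S k) = m choose k" for k
      using n_subsets[of "{1..m}" k] by simp
    have ne: "?S k \<noteq> {}" if "k \<le> m" for k
      using cd[of k] that by (metis binomial_eq_0_iff card.empty linorder_not_le)
    have pS: "pmf (pmf_of_set (?S k)) A = (if A \<in> ?S k then 1 / real (m choose k) else 0)"
      if "k \<le> m" for k
      using that fin ne cd by (simp add: pmf_of_set indicator_def)
    have "pmf Q A = (\<integral>k. pmf (pmf_of_set (?S k)) A \<partial>measure_pmf P)"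
      by (simp add: Q_def pmf_bind)
    also have "\<dots> = (\<Sum>k\<in>{0..m}. pmf (pmf_of_set (?S k)) A * pmf P k)"
      using assms by (intro integral_measure_pmf_real) auto
    also have "\<dots> = (\<Sum>k\<in>{0..m}. if k = card A
                       then (if A \<subseteq> {1..m} then pmf P k / real (m choose k) else 0) else 0)"
    proof (intro sum.cong refl, goal_cases)
      case (1 k)
      then have "k \<le> m" by simp
      then show ?case by (simp only: pS) (simp, blast?)
    qed
    also have "\<dots> = (if A \<subseteq> {1..m} then pmf P (card A) / real (m choose card A) else 0)"
    proof (cases "A \<subseteq> {1..m}")
      case True
      then have "card A \<le> m"
        using card_mono[of "{1..m}" A] by simp
      then show ?thesis by simp
    qed (simp add: if_distrib cong: if_cong)
    finally show ?thesis .
  qed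
  then have Q': "(\<lambda>A. if A \<subseteq> {1..m} then pmf P (card A) / real (m choose card A) else 0) = pmf Q"
    by (rule ext[OF sym])
  have "random_subset m P = embed_pmf (pmf Q)"
    unfolding random_subset_def Q' ..
  also have "\<dots> = Q"
    by (rule type_definition.Rep_inverse[OF td_pmf_embed_pmf])
  finally show ?thesis using Q by (rule ssubst)
qed

definition intersection_edges :: "nat \<Rightarrow> nat \<Rightarrow> (nat \<Rightarrow> nat set) \<Rightarrow> nat set set" where
  "intersection_edges s n D =
     {{i, j} | i j. i \<in> {1..n} \<and> j \<in> {1..n} \<and> i \<noteq> j \<and> s \<le> card (D i \<inter> D j)}"

text \<open>
  The random graph \<open>G\<^sub>s(n,m,P)\<close> on the vertex set \<open>{1..n}\<close>, given as the distribution of its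
  edge set; \<open>Pi_pmf\<close> makes \<open>D 1, \<dots>, D n\<close> independent.
\<close>

definition active_intersection_graph ::
    "nat \<Rightarrow> nat \<Rightarrow> nat \<Rightarrow> nat pmf \<Rightarrow> nat set set pmf" where
  "active_intersection_graph s n m P =
     map_pmf (intersection_edges s n) (Pi_pmf {1..n} {} (\<lambda>_. random_subset m P))"

text \<open>
  Meaningful for \<open>n \<ge> 3\<close>, in which case the value depends neither on \<open>n\<close> nor on the choice of
  the three distinct vertices.
\<close>

definition clustering_coefficient :: "nat \<Rightarrow> nat \<Rightarrow> nat \<Rightarrow> nat pmf \<Rightarrow> real" where
  "clustering_coefficient s n m P =
     \<P>(E in measure_pmf (active_intersection_graph s n m P).
        {2, 3} \<in> E \<bar> {1, 2} \<in> E \<and> {1, 3} \<in> E)"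

definition scaled_size :: "nat \<Rightarrow> nat \<Rightarrow> nat \<Rightarrow> nat \<Rightarrow> real" where
  "scaled_size s n m x =
     real (x choose s) * real (m choose s) powr (- 1 / 2) * real n powr (1 / 2)"

end

theory Submission
  imports Defs
begin

text \<open>
  Write \<open>a = (X choose s)\<close> and \<open>N = (m choose s)\<close>. Up to lower order terms, two vertices are
  adjacent through exactly one common \<open>s\<close>-subset of attributes. Hence the probability of the path
  \<open>v\<^sub>2 \<sim> v\<^sub>1 \<sim> v\<^sub>3\<close> is about \<open>E a\<^sup>2 (E a)\<^sup>2 / N\<^sup>2\<close>, and a triangle arises, up to lower order terms,
  from one \<open>s\<close>-subset shared by all three vertices, which has probability about \<open>(E a)\<^sup>3 / N\<^sup>2\<close>. So
  the clustering coefficient is asymptotically \<open>E a / E a\<^sup>2\<close>. After truncating the sizes at a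
  constant \<open>L\<close>, all corrections are smaller by a factor of order \<open>1/m\<close>; the truncation costs
  \<open>E (a\<^sup>2; X > L)\<close>, which is uniformly small since convergence in distribution together with
  convergence of second moments gives uniform integrability of \<open>Z\<^sub>m\<^sub>1\<^sup>2\<close>. Because \<open>a\<close> is
  \<open>Z\<^sub>m\<^sub>1 (N/n)\<^sup>1\<^sup>/\<^sup>2\<close>, the limit is \<open>\<mu> / (\<surd>\<beta> E Z\<^sup>2)\<close>, and the mixed Poisson law of \<open>d\<^sub>*\<close> has
  \<open>E d\<^sub>* = \<mu>\<^sup>2\<close> and \<open>E d\<^sub>* (d\<^sub>* - 1) = \<mu>\<^sup>2 E Z\<^sup>2\<close>.
\<close>

section \<open>Moments of random subsets\<close>

text \<open>By Pascal's rule with \<open>s = Suc r\<close>, raising \<open>k\<close> by one adds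
  \<open>k choose r\<close> on the left and \<open>s * (k choose s)\<close> to the last term on the
  right. Absorption gives \<open>s * (k choose s) = (k - r) * (k choose r)\<close>, which dominates
  once \<open>s \<le> k\<close>. This is a Bonferroni-type inequality: it bounds the adjacency
  indicator from below by binomial moments.\<close>

lemma binomial_le_of_bool_plus:
  assumes "1 \<le> s"
  shows "k choose s \<le> of_bool (s \<le> k) + s * (k choose Suc s)"
proof (induction k)
  case 0
  then show ?case using assms by simp
next
  case (Suc k)
  show ?case
  proof (cases "s \<le> k")
    case True
    obtain r where r: "s = Suc r" using assms by (cases s) auto
    have "k choose r \<le> (k - r) * (k choose r)"
      using True r by simp
    also have "(k - r) * (k choose r) = s * (k choose s)"
      by (metis r binomial_absorb_comp binomial_absorption)
    finally show ?thesis
      using Suc True by (simp add: r algebra_simps)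
  qed (auto simp: binomial_eq_0 not_less_eq_eq le_Suc_eq)
qed

lemma of_bool_le_binomial: "of_bool (s \<le> k) \<le> k choose s"
  by (simp add: Suc_le_eq)

text \<open>Finite supports reduce Fubini to exchanging two finite sums. It is what allows the three
  vertices to be permuted.\<close>

lemma expectation_swap_finite:
  fixes F :: "'a \<Rightarrow> 'b \<Rightarrow> real"
  assumes "finite (set_pmf p)" "finite (set_pmf q)"
  shows "measure_pmf.expectation p (\<lambda>x. measure_pmf.expectation q (F x)) =
         measure_pmf.expectation q (\<lambda>y. measure_pmf.expectation p (\<lambda>x. F x y))"
  by (subst (1 2 3 4) integral_measure_pmf_real[OF _ subset_refl[THEN subsetD]])
     (use assms in \<open>auto simp: sum_distrib_left sum_distrib_right mult_ac intro: sum.swap\<close>)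

lemma card_supersets_of_card:
  assumes "finite W" "S \<subseteq> W"
  shows "card {A. S \<subseteq> A \<and> A \<subseteq> W \<and> card A = card S + r} = (card W - card S) choose r"
proof -
  have fin: "finite S" using assms finite_subset by blast
  have "bij_betw (\<lambda>B. B \<union> S) {B. B \<subseteq> W - S \<and> card B = r}
          {A. S \<subseteq> A \<and> A \<subseteq> W \<and> card A = card S + r}"
  proof (rule bij_betw_byWitness[where f' = "\<lambda>A. A - S"])
    show "(\<lambda>B. B \<union> S) ` {B. B \<subseteq> W - S \<and> card B = r}
            \<subseteq> {A. S \<subseteq> A \<and> A \<subseteq> W \<and> card A = card S + r}"
    proof safe
      fix B assume B: "B \<subseteq> W - S" "r = card B"
      then show "card (B \<union> S) = card S + card B"
        using assms fin
        by (subst card_Un_disjoint) (auto intro: finite_subset)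
    qed (use assms in auto)
    show "(\<lambda>A. A - S) ` {A. S \<subseteq> A \<and> A \<subseteq> W \<and> card A = card S + r}
            \<subseteq> {B. B \<subseteq> W - S \<and> card B = r}"
      using fin by (auto simp: card_Diff_subset)
  qed auto
  then have "card {A. S \<subseteq> A \<and> A \<subseteq> W \<and> card A = card S + r} = card {B. B \<subseteq> W - S \<and> card B = r}"
    by (rule bij_betw_same_card[symmetric])
  also have "\<dots> = (card W - card S) choose r"
    using assms fin by (simp add: n_subsets card_Diff_subset)
  finally show ?thesis .
qed

lemma expectation_bind_finite:
  fixes h :: "'b \<Rightarrow> real"
  assumes "finite (set_pmf p)" "\<And>x. x \<in> set_pmf p \<Longrightarrow> finite (set_pmf (k x))"
  shows "measure_pmf.expectation (p \<bind> k) h =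
         measure_pmf.expectation p (\<lambda>x. measure_pmf.expectation (k x) h)"
  using assms
  by (subst pmf_expectation_bind[of "set_pmf p"])
    (auto simp: integral_measure_pmf_real[of "set_pmf p"] mult.commute)

lemma intersection_edges_iff:
  assumes "i \<in> {1..n}" "j \<in> {1..n}" "i \<noteq> j"
  shows "{i, j} \<in> intersection_edges s n D \<longleftrightarrow> s \<le> card (D i \<inter> D j)"
  using assms by (auto simp: intersection_edges_def doubleton_eq_iff Int_commute)

locale random_subset_model =
  fixes m :: nat and P :: "nat pmf"
  assumes P_range: "set_pmf P \<subseteq> {0..m}"
begin

abbreviation Q :: "nat set pmf" where "Q \<equiv> random_subset m P"

abbreviation EP :: "(nat \<Rightarrow> real) \<Rightarrow> real" where "EP f \<equiv> measure_pmf.expectation P f"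

abbreviation EQ :: "(nat set \<Rightarrow> real) \<Rightarrow> real" where "EQ h \<equiv> measure_pmf.expectation Q h"

lemma set_pmf_Q: "set_pmf Q \<subseteq> Pow {1..m}"
proof
  fix A assume "A \<in> set_pmf Q"
  then show "A \<in> Pow {1..m}"
    by (cases "A \<subseteq> {1..m}") (simp_all add: set_pmf_iff pmf_random_subset[OF P_range])
qed

lemma finite_set_pmf_Q [simp]: "finite (set_pmf Q)"
  using set_pmf_Q finite_subset by blast

lemma finite_set_pmf_P [simp]: "finite (set_pmf P)"
  using P_range finite_subset by blast

lemma integrable_Q [simp]: "integrable (measure_pmf Q) (h :: nat set \<Rightarrow> real)"
  by (rule integrable_measure_pmf_finite) simp

lemma integrable_P [simp]: "integrable (measure_pmf P) (h :: nat \<Rightarrow> real)"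
  by (rule integrable_measure_pmf_finite) simp

lemma EQ_mono: "(\<And>A. A \<subseteq> {1..m} \<Longrightarrow> g A \<le> h A) \<Longrightarrow> EQ g \<le> EQ h"
  using set_pmf_Q by (intro integral_mono_AE) (auto simp: AE_measure_pmf_iff)

lemma EQ_cong: "(\<And>A. A \<subseteq> {1..m} \<Longrightarrow> g A = h A) \<Longrightarrow> EQ g = EQ h"
  using set_pmf_Q by (intro integral_cong_AE) (auto simp: AE_measure_pmf_iff)

lemma EQ_eq_sum: "EQ h = (\<Sum>A\<in>Pow {1..m}. h A * (pmf P (card A) / real (m choose card A)))"
  using integral_measure_pmf_real[of "Pow {1..m}" Q h] set_pmf_Q
  by (auto simp: pmf_random_subset[OF P_range])

lemma EP_eq_sum: "EP f = (\<Sum>x\<le>m. f x * pmf P x)"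
  using P_range by (intro integral_measure_pmf_real) auto

text \<open>Given its size \<open>x\<close>, the set \<open>A\<close> is uniform, and the proportion
  of \<open>x\<close>-sets containing \<open>S\<close> is
  \<open>(x choose card S) / (m choose card S)\<close>, because \<open>(m choose x) * (x choose k) =
  (m choose k) * ((m - k) choose (x - k))\<close>. The weight \<open>f\<close> leaves room for
  truncating the size.\<close>

lemma EQ_superset:
  assumes "S \<subseteq> {1..m}"
  shows "EQ (\<lambda>A. f (card A) * of_bool (S \<subseteq> A)) =
         EP (\<lambda>x. f x * real (x choose card S)) / real (m choose card S)"
proof -
  let ?k = "card S"
  have km: "?k \<le> m" using card_mono[OF _ assms] by simp
  have count: "real (card {A \<in> Pow {1..m}. card A = x \<and> S \<subseteq> A}) / real (m choose x)
                 = real (x choose ?k) / real (m choose ?k)" if "x \<le> m" for x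
  proof (cases "?k \<le> x")
    case True
    have "{A \<in> Pow {1..m}. card A = x \<and> S \<subseteq> A} =
          {A. S \<subseteq> A \<and> A \<subseteq> {1..m} \<and> card A = ?k + (x - ?k)}"
      using True by auto
    then have "card {A \<in> Pow {1..m}. card A = x \<and> S \<subseteq> A} = (m - ?k) choose (x - ?k)"
      using card_supersets_of_card[of "{1..m}" S "x - ?k"] assms by simp
    moreover have "real (m choose x) * real (x choose ?k) =
        real (m choose ?k) * real ((m - ?k) choose (x - ?k))"
      unfolding of_nat_mult[symmetric] using choose_mult[OF True that] by simp
    ultimately show ?thesis
      using that km by (simp add: field_simps)
  next
    case False
    then have "{A \<in> Pow {1..m}. card A = x \<and> S \<subseteq> A} = {}"
      using card_mono[of _ S] finite_subset[of _ "{1..m}"] by fastforce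
    then show ?thesis using False by (simp only:) simp
  qed
  have "EQ (\<lambda>A. f (card A) * of_bool (S \<subseteq> A)) =
        (\<Sum>A\<in>Pow {1..m}. f (card A) * of_bool (S \<subseteq> A) * (pmf P (card A) / real (m choose card A)))"
    by (rule EQ_eq_sum)
  also have "\<dots> = (\<Sum>x\<le>m. \<Sum>A | A \<in> Pow {1..m} \<and> card A = x.
      f (card A) * of_bool (S \<subseteq> A) * (pmf P (card A) / real (m choose card A)))"
    by (rule sum.group[symmetric]) (use card_mono[of "{1..m}"] in auto)
  also have "\<dots> = (\<Sum>x\<le>m. f x * pmf P x *
      (real (card {A \<in> Pow {1..m}. card A = x \<and> S \<subseteq> A}) / real (m choose x)))"
  proof (intro sum.cong refl)
    fix x
    have "(\<Sum>A | A \<in> Pow {1..m} \<and> card A = x.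
        f (card A) * of_bool (S \<subseteq> A) * (pmf P (card A) / real (m choose card A))) =
        (\<Sum>A | A \<in> Pow {1..m} \<and> card A = x. f x * pmf P x / real (m choose x) * of_bool (S \<subseteq> A))"
      by (intro sum.cong) auto
    also have "\<dots> = f x * pmf P x / real (m choose x) *
        (\<Sum>A | A \<in> Pow {1..m} \<and> card A = x. of_bool (S \<subseteq> A))"
      by (rule sum_distrib_left[symmetric])
    also have "(\<Sum>A | A \<in> Pow {1..m} \<and> card A = x. of_bool (S \<subseteq> A)) =
        real (card {A \<in> Pow {1..m}. card A = x \<and> S \<subseteq> A})"
      by (subst sum_of_bool_eq) (auto intro!: arg_cong[where f = card])
    finally show "(\<Sum>A | A \<in> Pow {1..m} \<and> card A = x.
        f (card A) * of_bool (S \<subseteq> A) * (pmf P (card A) / real (m choose card A))) = f x * pmf P x *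
      (real (card {A \<in> Pow {1..m}. card A = x \<and> S \<subseteq> A}) / real (m choose x))"
      by simp
  qed
  also have "\<dots> = (\<Sum>x\<le>m. f x * pmf P x * (real (x choose ?k) / real (m choose ?k)))"
    using count by (intro sum.cong) auto
  also have "\<dots> = EP (\<lambda>x. f x * real (x choose ?k)) / real (m choose ?k)"
    unfolding EP_eq_sum by (simp add: sum_divide_distrib mult_ac)
  finally show ?thesis .
qed

text \<open>The binomial counts the \<open>k\<close>-subsets of \<open>T\<close> that lie in
  \<open>A\<close>, so linearity of expectation reduces it to \<open>EQ_superset\<close> for each
  such subset.\<close>

lemma EQ_binomial_inter:
  assumes "T \<subseteq> {1..m}"
  shows "EQ (\<lambda>A. f (card A) * real (card (A \<inter> T) choose k)) =
         real (card T choose k) / real (m choose k) * EP (\<lambda>x. f x * real (x choose k))"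
proof -
  have fT: "finite T" using assms finite_subset by blast
  have fS: "finite {S. S \<subseteq> T \<and> card S = k}" using fT by simp
  have count: "real (card (A \<inter> T) choose k) = (\<Sum>S | S \<subseteq> T \<and> card S = k. of_bool (S \<subseteq> A))" for A
  proof -
    have "{S. S \<subseteq> T \<and> card S = k} \<inter> {S. S \<subseteq> A} = {S. S \<subseteq> A \<inter> T \<and> card S = k}"
      by auto
    then show ?thesis
      using fT n_subsets[of "A \<inter> T" k] sum_of_bool_eq[OF fS, of "\<lambda>S. S \<subseteq> A"] by simp
  qed
  have "EQ (\<lambda>A. f (card A) * real (card (A \<inter> T) choose k)) =
        (\<Sum>S | S \<subseteq> T \<and> card S = k. EQ (\<lambda>A. f (card A) * of_bool (S \<subseteq> A)))"
    by (simp add: count sum_distrib_left)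
  also have "\<dots> = (\<Sum>S | S \<subseteq> T \<and> card S = k. EP (\<lambda>x. f x * real (x choose k)) / real (m choose k))"
    using assms by (intro sum.cong) (auto simp: EQ_superset)
  also have "\<dots> = real (card T choose k) / real (m choose k) * EP (\<lambda>x. f x * real (x choose k))"
    using n_subsets[OF fT, of k] by simp
  finally show ?thesis .
qed

section \<open>Joint moments of three independent random subsets\<close>

abbreviation EQ3 :: "(nat set \<Rightarrow> nat set \<Rightarrow> nat set \<Rightarrow> real) \<Rightarrow> real" where
  "EQ3 F \<equiv> EQ (\<lambda>A. EQ (\<lambda>B. EQ (\<lambda>C. F A B C)))"

lemma EQ3_mono:
  "(\<And>A B C. A \<subseteq> {1..m} \<Longrightarrow> B \<subseteq> {1..m} \<Longrightarrow> C \<subseteq> {1..m} \<Longrightarrow> F A B C \<le> G A B C) \<Longrightarrow> EQ3 F \<le> EQ3 G"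
  by (intro EQ_mono) blast

lemma EQ3_swap12: "EQ3 (\<lambda>A B C. F B A C) = EQ3 F"
  by (rule expectation_swap_finite) simp_all

lemma EQ3_swap23: "EQ3 (\<lambda>A B C. F A C B) = EQ3 F"
  by (intro EQ_cong expectation_swap_finite) simp_all

lemma EQ_card: "EQ (\<lambda>A. f (card A)) = EP f"
  using EQ_binomial_inter[of "{}" f 0] by simp

lemma EQ_binomial_inter':
  assumes "T \<subseteq> {1..m}"
  shows "EQ (\<lambda>A. f (card A) * real (card (T \<inter> A) choose k)) =
         real (card T choose k) / real (m choose k) * EP (\<lambda>x. f x * real (x choose k))"
  using EQ_binomial_inter[OF assms, of f k] by (simp add: Int_commute)

text \<open>With \<open>A\<close> fixed, \<open>B\<close> and \<open>C\<close> are independent and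
  enter through separate factors, so the inner expectations multiply and
  \<open>EQ_binomial_inter'\<close> evaluates each. Unequal orders \<open>j\<close> and
  \<open>k\<close> occur in the correction terms of the lower bound for paths.\<close>

lemma EQ3_path_moment:
  "EQ3 (\<lambda>A B C. g (card A) * (f (card B) * real (card (A \<inter> B) choose j)) *
          (h (card C) * real (card (A \<inter> C) choose k))) =
   EP (\<lambda>x. g x * real (x choose j) * real (x choose k)) * EP (\<lambda>x. f x * real (x choose j)) *
     EP (\<lambda>x. h x * real (x choose k)) / (real (m choose j) * real (m choose k))"
proof -
  have "EQ3 (\<lambda>A B C. g (card A) * (f (card B) * real (card (A \<inter> B) choose j)) *
          (h (card C) * real (card (A \<inter> C) choose k))) =
      EQ (\<lambda>A. g (card A) * real (card A choose j) * real (card A choose k) *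
        (EP (\<lambda>x. f x * real (x choose j)) * EP (\<lambda>x. h x * real (x choose k)) /
          (real (m choose j) * real (m choose k))))"
  proof (rule EQ_cong)
    fix A assume A: "A \<subseteq> {1..m}"
    have factor: "EQ (\<lambda>B. EQ (\<lambda>C. c * u B * v C)) = c * EQ u * EQ v" for c u v
      by (simp add: mult.assoc)
    have "EQ (\<lambda>B. EQ (\<lambda>C. g (card A) * (f (card B) * real (card (A \<inter> B) choose j)) *
          (h (card C) * real (card (A \<inter> C) choose k)))) =
        g (card A) * EQ (\<lambda>B. f (card B) * real (card (A \<inter> B) choose j)) *
          EQ (\<lambda>C. h (card C) * real (card (A \<inter> C) choose k))"
      by (rule factor)
    then show "EQ (\<lambda>B. EQ (\<lambda>C. g (card A) * (f (card B) * real (card (A \<inter> B) choose j)) *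
          (h (card C) * real (card (A \<inter> C) choose k)))) =
        g (card A) * real (card A choose j) * real (card A choose k) *
        (EP (\<lambda>x. f x * real (x choose j)) * EP (\<lambda>x. h x * real (x choose k)) /
          (real (m choose j) * real (m choose k)))"
      by (simp add: EQ_binomial_inter'[OF A])
  qed
  also have "\<dots> = EQ (\<lambda>A. g (card A) * real (card A choose j) * real (card A choose k)) *
        (EP (\<lambda>x. f x * real (x choose j)) * EP (\<lambda>x. h x * real (x choose k)) /
          (real (m choose j) * real (m choose k)))"
    by (rule integral_mult_left_zero)
  also have "EQ (\<lambda>A. g (card A) * real (card A choose j) * real (card A choose k)) =
      EP (\<lambda>x. g x * real (x choose j) * real (x choose k))"
    by (rule EQ_card)
  finally show ?thesis by simp
qed

text \<open>\<open>C\<close> is integrated out against the fixed set \<open>A \<inter> B\<close>,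
  then \<open>B\<close> against \<open>A\<close>; each integration contributes one factor
  \<open>1 / (m choose k)\<close>, and the last one over \<open>A\<close> contributes none.\<close>

lemma EQ3_triple_moment:
  "EQ3 (\<lambda>A B C. f (card A) * f (card B) * f (card C) * real (card (A \<inter> B \<inter> C) choose k)) =
   EP (\<lambda>x. f x * real (x choose k)) ^ 3 / real (m choose k) ^ 2"
proof -
  let ?e = "EP (\<lambda>x. f x * real (x choose k))" and ?N = "real (m choose k)"
  have "EQ3 (\<lambda>A B C. f (card A) * f (card B) * f (card C) * real (card (A \<inter> B \<inter> C) choose k)) =
      EQ (\<lambda>A. (f (card A) * real (card A choose k)) * (?e ^ 2 / ?N ^ 2))"
  proof (rule EQ_cong)
    fix A assume A: "A \<subseteq> {1..m}"
    have "EQ (\<lambda>B. EQ (\<lambda>C. f (card A) * f (card B) * f (card C) * real (card (A \<inter> B \<inter> C) choose k))) =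
        EQ (\<lambda>B. f (card A) * (?e / ?N) * (f (card B) * real (card (A \<inter> B) choose k)))"
    proof (rule EQ_cong)
      fix B assume "B \<subseteq> {1..m}"
      then have AB: "A \<inter> B \<subseteq> {1..m}" by auto
      show "EQ (\<lambda>C. f (card A) * f (card B) * f (card C) * real (card (A \<inter> B \<inter> C) choose k)) =
          f (card A) * (?e / ?N) * (f (card B) * real (card (A \<inter> B) choose k))"
        using EQ_binomial_inter'[OF AB, of f k] by (simp add: mult.assoc)
    qed
    also have "\<dots> = (f (card A) * real (card A choose k)) * (?e ^ 2 / ?N ^ 2)"
      by (simp add: EQ_binomial_inter'[OF A] power2_eq_square)
    finally show "EQ (\<lambda>B. EQ (\<lambda>C. f (card A) * f (card B) * f (card C) *
        real (card (A \<inter> B \<inter> C) choose k))) =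
      (f (card A) * real (card A choose k)) * (?e ^ 2 / ?N ^ 2)" .
  qed
  also have "\<dots> = ?e * (?e ^ 2 / ?N ^ 2)"
    using EQ_card[of "\<lambda>x. f x * real (x choose k)"] by simp
  finally show ?thesis by (simp add: power3_eq_cube power2_eq_square)
qed

text \<open>The marginal of a product law on the coordinates 1, 2, 3 is again a product, which
  unfolds into three nested expectations. From here on the graph on \<open>n\<close> vertices is
  replaced by a triple of independent sets.\<close>

lemma expectation_three_vertices:
  fixes n :: nat and G :: "nat set \<Rightarrow> nat set \<Rightarrow> nat set \<Rightarrow> real"
  assumes "3 \<le> n"
  shows "measure_pmf.expectation (Pi_pmf {1..n} {} (\<lambda>_. Q)) (\<lambda>D. G (D 1) (D 2) (D 3)) = EQ3 G"
proof -
  have "measure_pmf.expectation (Pi_pmf {1..n} {} (\<lambda>_. Q)) (\<lambda>D. G (D 1) (D 2) (D 3)) =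
        measure_pmf.expectation (Pi_pmf {1, 2, 3 :: nat} {} (\<lambda>_. Q)) (\<lambda>D. G (D 1) (D 2) (D 3))"
    using assms by (subst Pi_pmf_subset[of "{1..n}" "{1, 2, 3 :: nat}"]) auto
  also have "\<dots> = EQ3 G"
    by (simp add: Pi_pmf_insert' bind_assoc_pmf bind_return_pmf expectation_bind_finite)
  finally show ?thesis .
qed

lemma clustering_coefficient_eq:
  assumes "3 \<le> n"
  shows "clustering_coefficient s n m P =
    EQ3 (\<lambda>A B C. of_bool (s \<le> card (B \<inter> C)) * of_bool (s \<le> card (A \<inter> B)) * of_bool (s \<le> card (A \<inter> C))) /
    EQ3 (\<lambda>A B C. of_bool (s \<le> card (A \<inter> B)) * of_bool (s \<le> card (A \<inter> C)))"
proof -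
  let ?G = "active_intersection_graph s n m P"
  have prob: "measure_pmf.prob ?G {E. R E} =
      measure_pmf.expectation (Pi_pmf {1..n} {} (\<lambda>_. Q)) (\<lambda>D. of_bool (R (intersection_edges s n D)))" for R
  proof -
    have "measure_pmf.prob ?G {E. R E} = measure_pmf.expectation ?G (indicator {E. R E})"
      by simp
    also have "\<dots> = measure_pmf.expectation ?G (\<lambda>E. of_bool (R E))"
      by (intro Bochner_Integration.integral_cong) (simp_all add: indicator_def)
    finally show ?thesis by (simp add: active_intersection_graph_def)
  qed
  have e: "{2, 3} \<in> intersection_edges s n D \<longleftrightarrow> s \<le> card (D 2 \<inter> D 3)"
    "{1, 2} \<in> intersection_edges s n D \<longleftrightarrow> s \<le> card (D 1 \<inter> D 2)"
    "{1, 3} \<in> intersection_edges s n D \<longleftrightarrow> s \<le> card (D 1 \<inter> D 3)" for D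
    using assms by (intro intersection_edges_iff; simp)+
  have "clustering_coefficient s n m P =
      measure_pmf.prob ?G {E. {2, 3} \<in> E \<and> {1, 2} \<in> E \<and> {1, 3} \<in> E} /
      measure_pmf.prob ?G {E. {1, 2} \<in> E \<and> {1, 3} \<in> E}"
    by (simp add: clustering_coefficient_def cond_prob_def)
  also have "measure_pmf.prob ?G {E. {2, 3} \<in> E \<and> {1, 2} \<in> E \<and> {1, 3} \<in> E} =
      EQ3 (\<lambda>A B C. of_bool (s \<le> card (B \<inter> C)) * of_bool (s \<le> card (A \<inter> B)) * of_bool (s \<le> card (A \<inter> C)))"
    unfolding prob e expectation_three_vertices[OF assms, symmetric]
    by (simp add: of_bool_conj mult.assoc)
  also have "measure_pmf.prob ?G {E. {1, 2} \<in> E \<and> {1, 3} \<in> E} =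
      EQ3 (\<lambda>A B C. of_bool (s \<le> card (A \<inter> B)) * of_bool (s \<le> card (A \<inter> C)))"
    unfolding prob e expectation_three_vertices[OF assms, symmetric]
    by (simp add: of_bool_conj)
  finally show ?thesis .
qed

end

section \<open>Path and triangle probabilities\<close>

text \<open>\<open>A\<close> belongs to the middle vertex. The expression agrees with
  \<open>path_prob\<close> below but is written outside the locale, so that it can serve as a
  sequence in \<open>m\<close> although the locale assumptions are only available for large
  \<open>m\<close>.\<close>

definition path_probability :: "nat \<Rightarrow> nat \<Rightarrow> nat pmf \<Rightarrow> real" where
  "path_probability s m P =
     measure_pmf.expectation (random_subset m P) (\<lambda>A. measure_pmf.expectation (random_subset m P) (\<lambda>B.
       measure_pmf.expectation (random_subset m P) (\<lambda>C.
         of_bool (s \<le> card (A \<inter> B)) * of_bool (s \<le> card (A \<inter> C)))))"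

definition triangle_probability :: "nat \<Rightarrow> nat \<Rightarrow> nat pmf \<Rightarrow> real" where
  "triangle_probability s m P =
     measure_pmf.expectation (random_subset m P) (\<lambda>A. measure_pmf.expectation (random_subset m P) (\<lambda>B.
       measure_pmf.expectation (random_subset m P) (\<lambda>C.
         of_bool (s \<le> card (B \<inter> C)) * of_bool (s \<le> card (A \<inter> B)) * of_bool (s \<le> card (A \<inter> C)))))"

text \<open>\<open>L\<close> is the level at which sizes are truncated. The strict inequality
  \<open>s < m\<close> keeps \<open>m choose Suc s\<close> positive, as it occurs in
  denominators.\<close>

locale random_intersection_triple = random_subset_model +
  fixes s L :: nat
  assumes s_pos: "1 \<le> s" and s_less: "s < m"
begin

abbreviation "a x \<equiv> real (x choose s)"
abbreviation "f x \<equiv> (of_bool (x \<le> L) :: real)"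
abbreviation "adj A B \<equiv> (of_bool (s \<le> card (A \<inter> B)) :: real)"
abbreviation "N \<equiv> real (m choose s)"
abbreviation "N' \<equiv> real (m choose Suc s)"

abbreviation "path_prob \<equiv> EQ3 (\<lambda>A B C. adj A B * adj A C)"
abbreviation "triangle_prob \<equiv> EQ3 (\<lambda>A B C. adj B C * adj A B * adj A C)"
abbreviation "mean_a \<equiv> EP a"
abbreviation "square_a \<equiv> EP (\<lambda>x. a x ^ 2)"
abbreviation "tail_a \<equiv> EP (\<lambda>x. (1 - f x) * a x ^ 2)"

section \<open>Elementary bounds for adjacency indicators and truncated moments\<close>

lemma EP_mono: "(\<And>x. g x \<le> h x) \<Longrightarrow> EP g \<le> EP h"
  by (intro integral_mono) simp_all

lemma N_pos: "0 < N" "0 < N'"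
  using s_less by simp_all

lemma adj_le: "adj A B \<le> real (card (A \<inter> B) choose s)"
  using of_bool_le_binomial[of s "card (A \<inter> B)"] by (metis of_nat_le_iff of_nat_of_bool)

lemma adj_ge: "real (k choose s) - real s * real (k choose Suc s) \<le> of_bool (s \<le> k)"
proof -
  have "real (k choose s) \<le> real (of_bool (s \<le> k) + s * (k choose Suc s))"
    using binomial_le_of_bool_plus[OF s_pos, of k] by (simp only: of_nat_le_iff)
  then show ?thesis by simp
qed

lemma binomial_le_two_power: "n \<le> k \<Longrightarrow> real (n choose j) \<le> 2 ^ k"
proof -
  assume "n \<le> k"
  have "n choose j \<le> 2 ^ n" by (rule binomial_le_pow2)
  then have "real (n choose j) \<le> 2 ^ n" by (metis of_nat_le_iff of_nat_numeral of_nat_power)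
  also have "\<dots> \<le> 2 ^ k" using \<open>n \<le> k\<close> by simp
  finally show ?thesis .
qed

text \<open>The constant is crude; what matters is that it depends on \<open>L\<close> alone and
  stays fixed as \<open>m\<close> grows.\<close>

lemma truncated_moment_le: "EP (\<lambda>x. f x * real (x choose j)) \<le> 2 ^ L"
proof -
  have "EP (\<lambda>x. f x * real (x choose j)) \<le> EP (\<lambda>_. 2 ^ L)"
  proof (rule EP_mono)
    show "f x * real (x choose j) \<le> 2 ^ L" for x
      using binomial_le_two_power[of x L j] by (cases "x \<le> L") auto
  qed
  then show ?thesis by simp
qed

lemma truncated_product_moment_le: "EP (\<lambda>x. f x * real (x choose j) * real (x choose k)) \<le> 2 ^ (2 * L)"
proof -
  have "EP (\<lambda>x. f x * real (x choose j) * real (x choose k)) \<le> EP (\<lambda>_. 2 ^ L * 2 ^ L)"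
  proof (rule EP_mono)
    show "f x * real (x choose j) * real (x choose k) \<le> 2 ^ L * 2 ^ L" for x
      using mult_mono[OF binomial_le_two_power[of x L j] binomial_le_two_power[of x L k]]
      by (cases "x \<le> L") auto
  qed
  then show ?thesis by (simp add: power_add[symmetric] mult_2)
qed

lemma moment_nonneg [simp]:
  "0 \<le> mean_a" "0 \<le> square_a" "0 \<le> tail_a"
  "0 \<le> EP (\<lambda>x. f x * real (x choose j))"
  "0 \<le> EP (\<lambda>x. f x * real (x choose j) * real (x choose k))"
  by (auto intro!: integral_nonneg_AE)

text \<open>Each indicator is at most the number of common \<open>s\<close>-subsets, whose moments
  are known exactly. The weight \<open>1\<close> yields the upper bound for paths, and
  \<open>1 - f\<close> bounds triangles in which some size exceeds \<open>L\<close>.\<close>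

lemma weighted_path_upper:
  assumes "\<And>x. 0 \<le> g x"
  shows "EQ3 (\<lambda>A B C. g (card A) * adj A B * adj A C) \<le> EP (\<lambda>x. g x * a x ^ 2) * mean_a ^ 2 / N ^ 2"
proof -
  have "EQ3 (\<lambda>A B C. g (card A) * adj A B * adj A C) \<le>
      EQ3 (\<lambda>A B C. g (card A) * (1 * a (card (A \<inter> B))) * (1 * a (card (A \<inter> C))))"
  proof (rule EQ3_mono)
    fix A B C :: "nat set"
    have "g (card A) * (adj A B * adj A C) \<le> g (card A) * (a (card (A \<inter> B)) * a (card (A \<inter> C)))"
      by (intro mult_left_mono mult_mono adj_le assms) auto
    then show "g (card A) * adj A B * adj A C \<le>
        g (card A) * (1 * a (card (A \<inter> B))) * (1 * a (card (A \<inter> C)))"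
      by (simp only: mult.assoc mult_1)
  qed
  also have "\<dots> = EP (\<lambda>x. g x * a x ^ 2) * mean_a ^ 2 / N ^ 2"
    using EQ3_path_moment[of g "\<lambda>_. 1" s "\<lambda>_. 1" s] by (simp add: power2_eq_square mult.assoc)
  finally show ?thesis .
qed

lemma path_upper: "path_prob * N ^ 2 \<le> square_a * mean_a ^ 2"
  using weighted_path_upper[of "\<lambda>_. 1"] N_pos by (simp add: field_simps)

lemma nat_le_power2: "k \<le> k ^ 2" for k :: nat
  by (cases k) (auto simp: power2_eq_square)

text \<open>Since \<open>a x\<close> is a natural number, \<open>a x \<le> a x ^ 2\<close>. Hence
  the single quantity \<open>tail_a\<close> controls the truncation error of the first moment as
  well as that of the second.\<close>

lemma truncated_mean_ge: "mean_a - tail_a \<le> EP (\<lambda>x. f x * a x)"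
proof -
  have "mean_a - tail_a = EP (\<lambda>x. a x - (1 - f x) * a x ^ 2)"
    by simp
  also have "\<dots> \<le> EP (\<lambda>x. f x * a x)"
  proof (rule EP_mono)
    fix x
    have "a x \<le> a x ^ 2"
      unfolding of_nat_power[symmetric] of_nat_le_iff by (rule nat_le_power2)
    then show "a x - (1 - f x) * a x ^ 2 \<le> f x * a x" by simp
  qed
  finally show ?thesis .
qed

lemma truncated_square_eq: "EP (\<lambda>x. f x * a x * a x) = square_a - tail_a"
proof -
  have "square_a - tail_a = EP (\<lambda>x. a x ^ 2 - (1 - f x) * a x ^ 2)"
    by simp
  also have "(\<lambda>x. a x ^ 2 - (1 - f x) * a x ^ 2) = (\<lambda>x. f x * a x * a x)"
    by (auto simp: power2_eq_square)
  finally show ?thesis by simp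
qed

lemma truncated_mean_le: "EP (\<lambda>x. f x * a x) \<le> mean_a"
  by (rule EP_mono) simp

text \<open>All three sizes are restricted to at most \<open>L\<close>, and there the indicators are
  replaced by moments of order \<open>s\<close> minus corrections of order \<open>Suc s\<close>.
  Each correction trades a factor \<open>1 / N\<close> for \<open>1 / N'\<close>, which after
  scaling by \<open>N ^ 2\<close> leaves \<open>N / N'\<close>.\<close>

lemma path_lower:
  "square_a * mean_a ^ 2 - (mean_a ^ 2 + 2 * mean_a * square_a) * tail_a - 2 * real s * 2 ^ (4 * L) * (N / N')
     \<le> path_prob * N ^ 2"
proof -
  let ?b = "\<lambda>x. real (x choose Suc s)"
  let ?p = "EP (\<lambda>x. f x * a x)" and ?q = "EP (\<lambda>x. f x * ?b x)"
  let ?F = "\<lambda>j k A B C. f (card A) * (f (card B) * real (card (A \<inter> B) choose j)) *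
          (f (card C) * real (card (A \<inter> C) choose k))"
  \<comment> \<open>The two lower bounds from \<open>adj_ge\<close> may be negative and so cannot be
    multiplied. Instead the error is split as \<open>a i * (a k - of_bool (s \<le> k)) + (a i -
    of_bool (s \<le> i)) * of_bool (s \<le> k)\<close>, and each difference is estimated on its
    own.\<close>
  have pt: "a i * a k - s * (a i * ?b k) - s * (?b i * a k) \<le> of_bool (s \<le> i) * of_bool (s \<le> k)" for i k
  proof -
    have u: "(of_bool (s \<le> k) :: real) \<le> a k"
      using of_bool_le_binomial[of s k] by (metis of_nat_le_iff of_nat_of_bool)
    have "a i * (a k - of_bool (s \<le> k)) \<le> a i * (s * ?b k)"
      using adj_ge[of k] by (intro mult_left_mono) auto
    moreover have "(a i - of_bool (s \<le> i)) * of_bool (s \<le> k) \<le> (s * ?b i) * a k"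
      using adj_ge[of i] u by (intro mult_mono) auto
    ultimately show ?thesis by (simp add: algebra_simps)
  qed
  have linear: "EQ3 (\<lambda>A B C. F A B C - c * G A B C - c * H A B C) = EQ3 F - c * EQ3 G - c * EQ3 H"
    for F G H c
    by simp
  have "?p ^ 2 * (square_a - tail_a) / N ^ 2 - s * (EP (\<lambda>x. f x * a x * ?b x) * ?p * ?q / (N * N'))
       - s * (EP (\<lambda>x. f x * ?b x * a x) * ?q * ?p / (N' * N)) =
      EQ3 (?F s s) - s * EQ3 (?F s (Suc s)) - s * EQ3 (?F (Suc s) s)"
    unfolding EQ3_path_moment[of f f s f s] EQ3_path_moment[of f f s f "Suc s"]
      EQ3_path_moment[of f f "Suc s" f s] truncated_square_eq by (simp add: power2_eq_square mult_ac)
  also have "\<dots> = EQ3 (\<lambda>A B C. ?F s s A B C - s * ?F s (Suc s) A B C - s * ?F (Suc s) s A B C)"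
    by (rule linear[symmetric])
  also have "\<dots> \<le> path_prob"
  proof (rule EQ3_mono)
    fix A B C :: "nat set"
    have "?F s s A B C - s * ?F s (Suc s) A B C - s * ?F (Suc s) s A B C =
       (f (card A) * f (card B) * f (card C)) * (a (card (A \<inter> B)) * a (card (A \<inter> C))
         - s * (a (card (A \<inter> B)) * ?b (card (A \<inter> C))) - s * (?b (card (A \<inter> B)) * a (card (A \<inter> C))))"
      by (simp add: algebra_simps)
    also have "\<dots> \<le> (f (card A) * f (card B) * f (card C)) * (adj A B * adj A C)"
      by (intro mult_left_mono pt) simp
    also have "\<dots> \<le> adj A B * adj A C" by simp
    finally show "?F s s A B C - s * ?F s (Suc s) A B C - s * ?F (Suc s) s A B C \<le> adj A B * adj A C" .
  qed
  finally have "(?p ^ 2 * (square_a - tail_a) / N ^ 2 - s * (EP (\<lambda>x. f x * a x * ?b x) * ?p * ?q / (N * N'))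
       - s * (EP (\<lambda>x. f x * ?b x * a x) * ?q * ?p / (N' * N))) * N ^ 2 \<le> path_prob * N ^ 2"
    by (rule mult_right_mono) simp
  also have "(?p ^ 2 * (square_a - tail_a) / N ^ 2 - s * (EP (\<lambda>x. f x * a x * ?b x) * ?p * ?q / (N * N'))
       - s * (EP (\<lambda>x. f x * ?b x * a x) * ?q * ?p / (N' * N))) * N ^ 2 =
     ?p ^ 2 * (square_a - tail_a) - s * (N / N') * (EP (\<lambda>x. f x * a x * ?b x) * ?p * ?q)
       - s * (N / N') * (EP (\<lambda>x. f x * ?b x * a x) * ?q * ?p)"
    using N_pos by (simp add: field_simps power2_eq_square)
  finally have main: "?p ^ 2 * (square_a - tail_a) - s * (N / N') * (EP (\<lambda>x. f x * a x * ?b x) * ?p * ?q)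
       - s * (N / N') * (EP (\<lambda>x. f x * ?b x * a x) * ?q * ?p) \<le> path_prob * N ^ 2" .
  have e: "EP (\<lambda>x. f x * real (x choose j) * real (x choose k)) * EP (\<lambda>x. f x * real (x choose i))
      * EP (\<lambda>x. f x * real (x choose l)) \<le> 2 ^ (4 * L)" for i j k l
  proof -
    have "EP (\<lambda>x. f x * real (x choose j) * real (x choose k)) * EP (\<lambda>x. f x * real (x choose i))
      * EP (\<lambda>x. f x * real (x choose l)) \<le> 2 ^ (2 * L) * 2 ^ L * 2 ^ L"
      by (intro mult_mono truncated_moment_le truncated_product_moment_le) auto
    then show ?thesis by (simp add: power_add[symmetric])
  qed
  have e1: "s * (N / N') * (EP (\<lambda>x. f x * a x * ?b x) * ?p * ?q) \<le> s * (N / N') * 2 ^ (4 * L)"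
    by (intro mult_left_mono e) simp
  have e2: "s * (N / N') * (EP (\<lambda>x. f x * ?b x * a x) * ?q * ?p) \<le> s * (N / N') * 2 ^ (4 * L)"
    by (intro mult_left_mono e) simp
  \<comment> \<open>The loss equals \<open>mean_a ^ 2 * tail_a\<close>, caused by the middle vertex,
    plus \<open>(mean_a ^ 2 - ?p ^ 2) * (square_a - tail_a)\<close>, caused by the two ends.\<close>
  have "square_a * mean_a ^ 2 - (mean_a ^ 2 + 2 * mean_a * square_a) * tail_a \<le> ?p ^ 2 * (square_a - tail_a)"
  proof -
    have t: "square_a - tail_a \<le> square_a" "0 \<le> square_a - tail_a"
      using truncated_square_eq moment_nonneg(5)[of s s] by simp_all
    have "mean_a ^ 2 - ?p ^ 2 = (mean_a - ?p) * (mean_a + ?p)"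
      by (simp add: algebra_simps power2_eq_square)
    also have "\<dots> \<le> tail_a * (2 * mean_a)"
      using truncated_mean_ge truncated_mean_le by (intro mult_mono) auto
    finally have "(mean_a ^ 2 - ?p ^ 2) * (square_a - tail_a) \<le> tail_a * (2 * mean_a) * square_a"
      using t by (intro mult_mono) auto
    then show ?thesis by (simp add: algebra_simps)
  qed
  moreover have "2 * real s * 2 ^ (4 * L) * (N / N') = s * (N / N') * 2 ^ (4 * L) + s * (N / N') * 2 ^ (4 * L)"
    by simp
  ultimately show ?thesis using main e1 e2 by linarith
qed

text \<open>\<open>s\<close> attributes common to all three sets already force a triangle. Applying
  \<open>adj_ge\<close> to the triple intersection, with sizes at most \<open>L\<close>, leaves the
  triple moments of orders \<open>s\<close> and \<open>Suc s\<close>.\<close>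

lemma triangle_lower:
  "mean_a ^ 3 - 3 * mean_a ^ 2 * tail_a - real s * 2 ^ (3 * L) * (N / N') ^ 2 \<le> triangle_prob * N ^ 2"
proof -
  let ?b = "\<lambda>x. real (x choose Suc s)"
  let ?p = "EP (\<lambda>x. f x * a x)" and ?q = "EP (\<lambda>x. f x * ?b x)"
  let ?F = "\<lambda>k A B C. f (card A) * f (card B) * f (card C) * real (card (A \<inter> B \<inter> C) choose k)"
  have "?p ^ 3 / N ^ 2 - s * (?q ^ 3 / N' ^ 2) = EQ3 (\<lambda>A B C. ?F s A B C - s * ?F (Suc s) A B C)"
    using EQ3_triple_moment[of f s] EQ3_triple_moment[of f "Suc s"] by simp
  also have "\<dots> \<le> triangle_prob"
  proof (rule EQ3_mono)
    fix A B C :: "nat set"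
    assume sub: "A \<subseteq> {1..m}" "B \<subseteq> {1..m}"
    then have fin: "finite A" "finite B" by (auto intro: finite_subset)
    have "?F s A B C - s * ?F (Suc s) A B C =
       (f (card A) * f (card B) * f (card C)) * (a (card (A \<inter> B \<inter> C)) - s * ?b (card (A \<inter> B \<inter> C)))"
      by (simp add: algebra_simps)
    also have "\<dots> \<le> (f (card A) * f (card B) * f (card C)) * of_bool (s \<le> card (A \<inter> B \<inter> C))"
      by (intro mult_left_mono adj_ge) simp
    also have "\<dots> \<le> of_bool (s \<le> card (A \<inter> B \<inter> C))" by simp
    also have "\<dots> \<le> adj B C * adj A B * adj A C"
    proof -
      have "card (A \<inter> B \<inter> C) \<le> card (A \<inter> B)" "card (A \<inter> B \<inter> C) \<le> card (A \<inter> C)"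
        "card (A \<inter> B \<inter> C) \<le> card (B \<inter> C)"
        using fin by (auto intro!: card_mono)
      then show ?thesis by auto
    qed
    finally show "?F s A B C - s * ?F (Suc s) A B C \<le> adj B C * adj A B * adj A C" .
  qed
  finally have "(?p ^ 3 / N ^ 2 - s * (?q ^ 3 / N' ^ 2)) * N ^ 2 \<le> triangle_prob * N ^ 2"
    by (rule mult_right_mono) simp
  moreover have "(?p ^ 3 / N ^ 2 - s * (?q ^ 3 / N' ^ 2)) * N ^ 2 = ?p ^ 3 - s * (N / N') ^ 2 * ?q ^ 3"
    using N_pos by (simp add: field_simps)
  moreover have "s * (N / N') ^ 2 * ?q ^ 3 \<le> s * (N / N') ^ 2 * 2 ^ (3 * L)"
    using power_mono[OF truncated_moment_le, of "Suc s" 3]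
    by (intro mult_left_mono) (simp_all add: power_mult[symmetric] mult.commute)
  moreover have "mean_a ^ 3 - 3 * mean_a ^ 2 * tail_a \<le> ?p ^ 3"
  proof -
    have "mean_a ^ 3 - ?p ^ 3 = (mean_a - ?p) * (mean_a * mean_a + mean_a * ?p + ?p * ?p)"
      by (simp add: algebra_simps power3_eq_cube)
    also have "\<dots> \<le> tail_a * (mean_a * mean_a + mean_a * mean_a + mean_a * mean_a)"
      using truncated_mean_ge truncated_mean_le by (intro mult_mono add_mono) auto
    finally show ?thesis by (simp add: algebra_simps power2_eq_square)
  qed
  ultimately show ?thesis by (simp add: algebra_simps)
qed

text \<open>
  If \<open>A\<close>, \<open>B\<close>, \<open>C\<close> intersect pairwise in \<open>s\<close> points but not in \<open>s\<close> common points, then \<open>C\<close>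
  meets \<open>A \<union> B\<close> in at least \<open>2s - (s - 1)\<close> points, which costs an extra factor \<open>1/m\<close>.
\<close>

lemma triangle_le_cases:
  assumes "finite A" "finite B" "finite C"
  shows "adj B C * adj A B * adj A C \<le> a (card (A \<inter> B \<inter> C)) +
      f (card A) * f (card B) * f (card C) * a (card (A \<inter> B)) * real (card ((A \<union> B) \<inter> C) choose Suc s) +
      (1 - f (card A)) * adj A B * adj A C + (1 - f (card B)) * adj B A * adj B C +
      (1 - f (card C)) * adj C A * adj C B"
    (is "?t \<le> ?x + ?y + ?u + ?v + ?w")
proof -
  have nn: "0 \<le> ?x" "0 \<le> ?y" "0 \<le> ?u" "0 \<le> ?v" "0 \<le> ?w" by auto
  show ?thesis
  proof (cases "s \<le> card (B \<inter> C) \<and> s \<le> card (A \<inter> B) \<and> s \<le> card (A \<inter> C)")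
    case False
    then have "?t = 0" by auto
    then show ?thesis using nn by linarith
  next
    case adj: True
    then have t: "?t = 1" by simp
    \<comment> \<open>In each case one of the five nonnegative summands is at least 1.\<close>
    consider "L < card A" | "L < card B" | "L < card C" | "s \<le> card (A \<inter> B \<inter> C)"
      | "card A \<le> L" "card B \<le> L" "card C \<le> L" "card (A \<inter> B \<inter> C) < s"
      by linarith
    then show ?thesis
    proof cases
      case 1
      then have "?u = 1" using adj by simp
      then show ?thesis using nn t by linarith
    next
      case 2
      then have "?v = 1" using adj by (simp add: Int_commute)
      then show ?thesis using nn t by linarith
    next
      case 3
      then have "?w = 1" using adj by (simp add: Int_commute)
      then show ?thesis using nn t by linarith
    next
      case 4
      then have "1 \<le> ?x" using binomial_eq_0_iff[of "card (A \<inter> B \<inter> C)" s] by (simp add: Suc_le_eq)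
      then show ?thesis using nn t by linarith
    next
      case 5
      have "card (A \<inter> C) + card (B \<inter> C) = card ((A \<inter> C) \<union> (B \<inter> C)) + card ((A \<inter> C) \<inter> (B \<inter> C))"
        by (rule card_Un_Int) (use assms in auto)
      moreover have "(A \<inter> C) \<union> (B \<inter> C) = (A \<union> B) \<inter> C" "(A \<inter> C) \<inter> (B \<inter> C) = A \<inter> B \<inter> C"
        by auto
      ultimately have "card (A \<inter> C) + card (B \<inter> C) = card ((A \<union> B) \<inter> C) + card (A \<inter> B \<inter> C)"
        by (simp only:)
      then have "Suc s \<le> card ((A \<union> B) \<inter> C)"
        using 5(4) s_pos conjunct1[OF adj] conjunct2[OF conjunct2[OF adj]] by linarith
      then have "1 \<le> a (card (A \<inter> B)) * real (card ((A \<union> B) \<inter> C) choose Suc s)"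
        using mult_mono[of 1 "a (card (A \<inter> B))" 1 "real (card ((A \<union> B) \<inter> C) choose Suc s)"] adj
        by (simp add: Suc_le_eq)
      then have "1 \<le> ?y" using 5 by (simp add: mult.assoc)
      then show ?thesis using nn t by linarith
    qed
  qed
qed

text \<open>Integrating out \<open>C\<close> first gives a factor \<open>1 / N'\<close> and a
  constant, because the truncated union \<open>A \<union> B\<close> has at most \<open>2 * L\<close>
  elements. Integrating out \<open>B\<close> then gives \<open>1 / N\<close>. The exponent
  \<open>5 * L\<close> collects \<open>3 * L\<close> from \<open>C\<close> and \<open>L\<close> each
  from \<open>B\<close> and \<open>A\<close>.\<close>

lemma bad_triangle_upper:
  "EQ3 (\<lambda>A B C. f (card A) * f (card B) * f (card C) * a (card (A \<inter> B)) *
      real (card ((A \<union> B) \<inter> C) choose Suc s)) * N ^ 2 \<le> 2 ^ (5 * L) * (N / N')"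
proof -
  let ?b = "\<lambda>x. real (x choose Suc s)"
  let ?q = "EP (\<lambda>x. f x * ?b x)"
  have "EQ3 (\<lambda>A B C. f (card A) * f (card B) * f (card C) * a (card (A \<inter> B)) *
      ?b (card ((A \<union> B) \<inter> C))) \<le>
    EQ (\<lambda>A. EQ (\<lambda>B. (f (card A) * (2 ^ (3 * L) / N')) * (f (card B) * a (card (A \<inter> B)))))"
  proof (intro EQ_mono)
    fix A B :: "nat set"
    assume A: "A \<subseteq> {1..m}" and B: "B \<subseteq> {1..m}"
    then have AB: "A \<union> B \<subseteq> {1..m}" by auto
    have "EQ (\<lambda>C. f (card A) * f (card B) * f (card C) * a (card (A \<inter> B)) *
      ?b (card ((A \<union> B) \<inter> C))) =
      EQ (\<lambda>C. (f (card A) * f (card B) * a (card (A \<inter> B))) * (f (card C) * ?b (card ((A \<union> B) \<inter> C))))"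
      by (simp add: mult_ac)
    also have "\<dots> = (f (card A) * f (card B) * a (card (A \<inter> B))) * (?b (card (A \<union> B)) / N' * ?q)"
      using EQ_binomial_inter'[OF AB, of f "Suc s"] by (simp only: integral_mult_right_zero)
    also have "\<dots> \<le> (f (card A) * f (card B) * a (card (A \<inter> B))) * (2 ^ (3 * L) / N')"
    \<comment> \<open>If \<open>A\<close> or \<open>B\<close> is larger than \<open>L\<close>, the
      truncation makes both sides zero.\<close>
    proof (cases "card A \<le> L \<and> card B \<le> L")
      case True
      then have "card (A \<union> B) \<le> 2 * L" using card_Un_le[of A B] by linarith
      then have "?b (card (A \<union> B)) * ?q \<le> 2 ^ (2 * L) * 2 ^ L"
        by (intro mult_mono truncated_moment_le binomial_le_two_power) auto
      also have "\<dots> = 2 ^ (3 * L)" by (simp add: power_add[symmetric])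
      finally show ?thesis
        by (intro mult_left_mono) (simp_all add: divide_right_mono)
    qed auto
    finally show "EQ (\<lambda>C. f (card A) * f (card B) * f (card C) * a (card (A \<inter> B)) *
      ?b (card ((A \<union> B) \<inter> C))) \<le> (f (card A) * (2 ^ (3 * L) / N')) * (f (card B) * a (card (A \<inter> B)))"
      by (simp add: mult_ac)
  qed
  also have "\<dots> = EQ (\<lambda>A. (f (card A) * a (card A)) * ((2 ^ (3 * L) / N') * (EP (\<lambda>x. f x * a x) / N)))"
  proof (rule EQ_cong)
    fix A assume A: "A \<subseteq> {1..m}"
    show "EQ (\<lambda>B. (f (card A) * (2 ^ (3 * L) / N')) * (f (card B) * a (card (A \<inter> B)))) =
      (f (card A) * a (card A)) * ((2 ^ (3 * L) / N') * (EP (\<lambda>x. f x * a x) / N))"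
      unfolding integral_mult_right_zero EQ_binomial_inter'[OF A, of f s] by (simp add: mult_ac)
  qed
  also have "\<dots> = EP (\<lambda>x. f x * a x) * ((2 ^ (3 * L) / N') * (EP (\<lambda>x. f x * a x) / N))"
    by (subst integral_mult_left_zero) (rule arg_cong[OF EQ_card])
  also have "\<dots> \<le> 2 ^ L * ((2 ^ (3 * L) / N') * (2 ^ L / N))"
    by (intro mult_mono divide_right_mono truncated_moment_le) auto
  also have "\<dots> = 2 ^ (5 * L) / (N * N')"
    by (simp add: power_add[symmetric])
  finally have "EQ3 (\<lambda>A B C. f (card A) * f (card B) * f (card C) * a (card (A \<inter> B)) *
      ?b (card ((A \<union> B) \<inter> C))) * N ^ 2 \<le> 2 ^ (5 * L) / (N * N') * N ^ 2"
    by (rule mult_right_mono) simp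
  then show ?thesis using N_pos by (simp add: power2_eq_square)
qed

text \<open>The pointwise case bound is integrated. Its first term is the triple moment, its second
  is \<open>bad_triangle_upper\<close>, and the last three are paths centred at a set larger than
  \<open>L\<close>, which have equal expectation by exchangeability.\<close>

lemma triangle_upper:
  "triangle_prob * N ^ 2 \<le> mean_a ^ 3 + 3 * mean_a ^ 2 * tail_a + 2 ^ (5 * L) * (N / N')"
proof -
  let ?y = "\<lambda>A B C. f (card A) * f (card B) * f (card C) * a (card (A \<inter> B)) * real (card ((A \<union> B) \<inter> C) choose Suc s)"
  let ?u = "\<lambda>A B C. (1 - f (card A)) * adj A B * adj A C"
  have scale: "(x / N ^ 2 + y + 3 * (t * z / N ^ 2)) * N ^ 2 = x + 3 * z * t + y * N ^ 2" for x y z t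
    using N_pos by (simp add: field_simps)
  have "triangle_prob \<le> EQ3 (\<lambda>A B C. a (card (A \<inter> B \<inter> C)) + ?y A B C + ?u A B C + ?u B A C + ?u C A B)"
    by (rule EQ3_mono, rule triangle_le_cases) (auto intro: finite_subset)
  also have "\<dots> = EQ3 (\<lambda>A B C. a (card (A \<inter> B \<inter> C))) + EQ3 ?y + EQ3 ?u +
      EQ3 (\<lambda>A B C. ?u B A C) + EQ3 (\<lambda>A B C. ?u C A B)"
    by simp
  also have "EQ3 (\<lambda>A B C. a (card (A \<inter> B \<inter> C))) = mean_a ^ 3 / N ^ 2"
    using EQ3_triple_moment[of "\<lambda>_. 1" s] by simp
  also have "EQ3 (\<lambda>A B C. ?u C A B) = EQ3 (\<lambda>A B C. ?u B A C)"
    by (rule EQ3_swap23[symmetric])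
  also have "EQ3 (\<lambda>A B C. ?u B A C) = EQ3 ?u"
    by (rule EQ3_swap12)
  finally have "triangle_prob \<le> mean_a ^ 3 / N ^ 2 + EQ3 ?y + 3 * EQ3 ?u"
    by simp
  also have "EQ3 ?u \<le> tail_a * mean_a ^ 2 / N ^ 2"
    using weighted_path_upper[of "\<lambda>x. 1 - f x"] by simp
  finally have "triangle_prob \<le> mean_a ^ 3 / N ^ 2 + EQ3 ?y + 3 * (tail_a * mean_a ^ 2 / N ^ 2)"
    by simp
  then have "triangle_prob * N ^ 2 \<le> (mean_a ^ 3 / N ^ 2 + EQ3 ?y + 3 * (tail_a * mean_a ^ 2 / N ^ 2)) * N ^ 2"
    by (rule mult_right_mono) simp
  also have "\<dots> = mean_a ^ 3 + 3 * mean_a ^ 2 * tail_a + EQ3 ?y * N ^ 2"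
    by (rule scale)
  finally show ?thesis
    using bad_triangle_upper by linarith
qed

section \<open>Two-sided error bounds and the size of the error ratio\<close>

lemma path_bounds:
  "\<bar>path_probability s m P * N ^ 2 - square_a * mean_a ^ 2\<bar> \<le>
     (mean_a ^ 2 + 2 * mean_a * square_a) * tail_a + 2 * real s * 2 ^ (4 * L) * (N / N')"
proof -
  have nonneg: "0 \<le> (mean_a ^ 2 + 2 * mean_a * square_a) * tail_a" "0 \<le> 2 * real s * 2 ^ (4 * L) * (N / N')"
    by (intro mult_nonneg_nonneg add_nonneg_nonneg moment_nonneg; simp)+
  show ?thesis
    using path_lower path_upper nonneg unfolding path_probability_def by linarith
qed

lemma triangle_bounds:
  "\<bar>triangle_probability s m P * N ^ 2 - mean_a ^ 3\<bar> \<le>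
     3 * mean_a ^ 2 * tail_a + (real s * 2 ^ (3 * L) * (N / N') ^ 2 + 2 ^ (5 * L) * (N / N'))"
proof -
  have nonneg: "0 \<le> real s * 2 ^ (3 * L) * (N / N') ^ 2" "0 \<le> 2 ^ (5 * L) * (N / N')"
    by simp_all
  show ?thesis
    using triangle_lower triangle_upper nonneg unfolding triangle_probability_def by linarith
qed

text \<open>Absorption relates the two consecutive binomials. For bounded \<open>s\<close> the ratio
  is of order \<open>1 / m\<close>, so for fixed \<open>L\<close> every error term without
  \<open>tail_a\<close> vanishes.\<close>

lemma binomial_ratio: "N / N' = real (Suc s) / real (m - s)"
proof -
  have "Suc s * (m choose Suc s) = (m - s) * (m choose s)"
    by (metis binomial_absorb_comp binomial_absorption)
  then have "real (Suc s) * N' = real (m - s) * N"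
    unfolding of_nat_mult[symmetric] by (rule arg_cong)
  then show ?thesis
    using N_pos s_less by (simp add: frac_eq_eq mult.commute)
qed

end

section \<open>Weak limits with convergent second moments\<close>

lemma real_distribution_distr_pmf:
  "real_distribution (distr (measure_pmf p) borel (g :: 'a \<Rightarrow> real))"
  by (intro prob_space.real_distribution_distr measure_pmf.prob_space_axioms) simp

lemma weak_conv_expectation:
  fixes \<phi> :: "real \<Rightarrow> real"
  assumes "prob_space M" and Z [measurable]: "Z \<in> borel_measurable M"
    and conv: "weak_conv_m (\<lambda>m. distr (measure_pmf (P m)) borel (g m)) (distr M borel Z)"
    and cont: "continuous_on UNIV \<phi>" and bdd: "\<And>z. \<bar>\<phi> z\<bar> \<le> B"
  shows "(\<lambda>m. measure_pmf.expectation (P m) (\<lambda>x. \<phi> (g m x))) \<longlonglongrightarrow> prob_space.expectation M (\<lambda>\<omega>. \<phi> (Z \<omega>))"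
proof -
  interpret prob_space M by fact
  have [measurable]: "\<phi> \<in> borel_measurable borel"
    using cont by (rule borel_measurable_continuous_onI)
  have "(\<lambda>m. integral\<^sup>L (distr (measure_pmf (P m)) borel (g m)) \<phi>) \<longlonglongrightarrow> integral\<^sup>L (distr M borel Z) \<phi>"
    by (rule weak_conv_imp_integral_bdd_continuous_conv[OF real_distribution_distr_pmf _ conv])
      (use cont bdd in \<open>auto simp: continuous_on_eq_continuous_at intro!: real_distribution_distr\<close>)
  then show ?thesis by (simp add: integral_distr)
qed

text \<open>Here \<open>g m\<close> stands for the scaled size. Finite supports make every real
  function integrable for large \<open>m\<close>, so expectations can be split freely.\<close>

locale l2_weak_limit = prob_space M for M :: "'a measure" +
  fixes Z :: "'a \<Rightarrow> real" and P :: "nat \<Rightarrow> 'c pmf" and g :: "nat \<Rightarrow> 'c \<Rightarrow> real"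
  assumes Z_measurable [measurable]: "Z \<in> borel_measurable M"
    and Z_conv: "weak_conv_m (\<lambda>m. distr (measure_pmf (P m)) borel (g m)) (distr M borel Z)"
    and Z_square_integrable: "integrable M (\<lambda>\<omega>. (Z \<omega>)\<^sup>2)"
    and Z_square_lim: "(\<lambda>m. measure_pmf.expectation (P m) (\<lambda>x. (g m x)\<^sup>2)) \<longlonglongrightarrow> expectation (\<lambda>\<omega>. (Z \<omega>)\<^sup>2)"
    and finite_support: "\<forall>\<^sub>F m in sequentially. finite (set_pmf (P m))"
begin

lemma Z_integrable: "integrable M Z"
  using Z_measurable Z_square_integrable by (rule square_integrable_imp_integrable)

lemma bounded_continuous_lim:
  fixes \<phi> :: "real \<Rightarrow> real"
  assumes "continuous_on UNIV \<phi>" "\<And>z. \<bar>\<phi> z\<bar> \<le> B"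
  shows "(\<lambda>m. measure_pmf.expectation (P m) (\<lambda>x. \<phi> (g m x))) \<longlonglongrightarrow> expectation (\<lambda>\<omega>. \<phi> (Z \<omega>))"
  using weak_conv_expectation[OF prob_space_axioms Z_measurable Z_conv assms] .

text \<open>Weak convergence handles the bounded continuous clipping \<open>c\<close> of the
  identity at \<open>K\<close>. The clipping error is at most \<open>z\<^sup>2 / K\<close>,
  uniformly small because second moments are bounded.\<close>

lemma mean_lim: "(\<lambda>m. measure_pmf.expectation (P m) (g m)) \<longlonglongrightarrow> expectation Z"
proof (rule LIMSEQ_I)
  fix e :: real assume e: "0 < e"
  \<comment> \<open>\<open>V\<close> exceeds the limit of the second moments and thus bounds all but
    finitely many of them. \<open>K\<close> is chosen so that clipping costs at most
    \<open>V / K = e / 4\<close>, both for \<open>g m\<close> and for \<open>Z\<close>.\<close>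
  define V where "V = expectation (\<lambda>\<omega>. (Z \<omega>)\<^sup>2) + 1"
  have V: "1 \<le> V" unfolding V_def by simp
  define K where "K = 4 * V / e"
  have K: "0 < K" using V e by (simp add: K_def)
  have VK: "V / K = e / 4" using V e by (simp add: K_def)
  define c where "c z = max (- K) (min z K)" for z :: real
  have c_diff: "\<bar>z - c z\<bar> \<le> z\<^sup>2 / K" for z
  proof (cases "\<bar>z\<bar> \<le> K")
    case True
    then have "c z = z" by (auto simp: c_def)
    then show ?thesis using K by simp
  next
    case False
    have "\<bar>z\<bar> * K \<le> \<bar>z\<bar> * \<bar>z\<bar>" using False by (intro mult_left_mono) auto
    then have "\<bar>z\<bar> \<le> z\<^sup>2 / K" using K by (simp add: field_simps power2_eq_square)
    then show ?thesis using False K by (auto simp: c_def max_def min_def)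
  qed
  have c_cont: "continuous_on UNIV c" unfolding c_def by (intro continuous_intros)
  have c_bdd: "\<bar>c z\<bar> \<le> K" for z using K by (auto simp: c_def)
  have [measurable]: "c \<in> borel_measurable borel"
    using c_cont by (rule borel_measurable_continuous_onI)
  have "integrable M (\<lambda>\<omega>. c (Z \<omega>))"
    by (rule integrable_const_bound[of _ K]) (use c_bdd in auto)
  then have "\<bar>expectation Z - expectation (\<lambda>\<omega>. c (Z \<omega>))\<bar> = \<bar>expectation (\<lambda>\<omega>. Z \<omega> - c (Z \<omega>))\<bar>"
    using Z_integrable by simp
  also have "\<dots> \<le> expectation (\<lambda>\<omega>. \<bar>Z \<omega> - c (Z \<omega>)\<bar>)"
    by (rule integral_abs_bound)
  also have "\<dots> \<le> expectation (\<lambda>\<omega>. (Z \<omega>)\<^sup>2 / K)"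
    using Z_integrable \<open>integrable M (\<lambda>\<omega>. c (Z \<omega>))\<close> Z_square_integrable c_diff
    by (intro integral_mono) auto
  also have "\<dots> \<le> V / K"
    using K by (simp add: V_def divide_right_mono)
  finally have Z_close: "\<bar>expectation Z - expectation (\<lambda>\<omega>. c (Z \<omega>))\<bar> \<le> e / 4"
    using VK by simp
  have close: "\<bar>x - z\<bar> < e"
    if "\<bar>x - y\<bar> \<le> e / 4" "\<bar>z - w\<bar> \<le> e / 4" "\<bar>y - w\<bar> < e / 4" "0 < e" for x y z w :: real
    using that by linarith
  have "\<forall>\<^sub>F m in sequentially. measure_pmf.expectation (P m) (\<lambda>x. (g m x)\<^sup>2) < V"
    using Z_square_lim by (rule order_tendstoD) (simp add: V_def)
  moreover have "\<forall>\<^sub>F m in sequentially.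
      dist (measure_pmf.expectation (P m) (\<lambda>x. c (g m x))) (expectation (\<lambda>\<omega>. c (Z \<omega>))) < e / 4"
    using bounded_continuous_lim[OF c_cont c_bdd] e by (intro tendstoD) auto
  ultimately have "\<forall>\<^sub>F m in sequentially. norm (measure_pmf.expectation (P m) (g m) - expectation Z) < e"
    using finite_support
  proof eventually_elim
    case (elim m)
    have int: "integrable (measure_pmf (P m)) h" for h :: "'c \<Rightarrow> real"
      using elim by (intro integrable_measure_pmf_finite)
    have "\<bar>measure_pmf.expectation (P m) (g m) - measure_pmf.expectation (P m) (\<lambda>x. c (g m x))\<bar> =
        \<bar>measure_pmf.expectation (P m) (\<lambda>x. g m x - c (g m x))\<bar>"
      using int by simp
    also have "\<dots> \<le> measure_pmf.expectation (P m) (\<lambda>x. \<bar>g m x - c (g m x)\<bar>)"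
      by (rule integral_abs_bound)
    also have "\<dots> \<le> measure_pmf.expectation (P m) (\<lambda>x. (g m x)\<^sup>2 / K)"
      using int c_diff by (intro integral_mono) auto
    also have "\<dots> \<le> V / K"
      using elim K by (simp add: divide_right_mono)
    finally have "\<bar>measure_pmf.expectation (P m) (g m) - measure_pmf.expectation (P m) (\<lambda>x. c (g m x))\<bar> \<le> e / 4"
      using VK by simp
    then show ?case
      using Z_close elim(2) e unfolding dist_real_def real_norm_def by (rule close)
  qed
  then show "\<exists>m0. \<forall>m\<ge>m0. norm (measure_pmf.expectation (P m) (g m) - expectation Z) < e"
    by (simp add: eventually_sequentially)
qed

text \<open>This is uniform integrability of the squares. The capped square \<open>?c k\<close> is
  bounded and continuous, so its expectations converge; as the full second moments converge too, the
  excess over the cap is eventually below \<open>e / 2\<close>, once \<open>k\<close> is large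
  enough for the limit \<open>Z\<close>.\<close>

lemma square_tail_small:
  assumes "0 < e"
  obtains K where "0 < K"
    "\<forall>\<^sub>F m in sequentially. measure_pmf.expectation (P m) (\<lambda>x. of_bool (K < g m x) * (g m x)\<^sup>2) < e"
proof -
  let ?c = "\<lambda>k z. min (z\<^sup>2) ((real k)\<^sup>2)"
  have "(\<lambda>k. expectation (\<lambda>\<omega>. ?c k (Z \<omega>))) \<longlonglongrightarrow> expectation (\<lambda>\<omega>. (Z \<omega>)\<^sup>2)"
  proof (rule integral_dominated_convergence[where w = "\<lambda>\<omega>. (Z \<omega>)\<^sup>2"])
    show "AE \<omega> in M. (\<lambda>k. ?c k (Z \<omega>)) \<longlonglongrightarrow> (Z \<omega>)\<^sup>2"
    proof (rule AE_I2, rule tendsto_eventually)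
      fix \<omega>
      show "\<forall>\<^sub>F k in sequentially. ?c k (Z \<omega>) = (Z \<omega>)\<^sup>2"
        using eventually_ge_at_top[of "nat \<lceil>\<bar>Z \<omega>\<bar>\<rceil>"]
      proof eventually_elim
        case (elim k)
        then have "\<bar>Z \<omega>\<bar> \<le> \<bar>real k\<bar>" by linarith
        then have "(Z \<omega>)\<^sup>2 \<le> (real k)\<^sup>2" by (rule abs_le_square_iff[THEN iffD1])
        then show ?case by (rule min_absorb1)
      qed
    qed
  qed (use Z_square_integrable in auto)
  then have "\<forall>\<^sub>F k in sequentially. expectation (\<lambda>\<omega>. (Z \<omega>)\<^sup>2) - e / 2 < expectation (\<lambda>\<omega>. ?c k (Z \<omega>))"
    by (rule order_tendstoD) (use assms in simp)
  then have "\<forall>\<^sub>F k in sequentially. 0 < k \<and> expectation (\<lambda>\<omega>. (Z \<omega>)\<^sup>2) - e / 2 < expectation (\<lambda>\<omega>. ?c k (Z \<omega>))"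
    using eventually_gt_at_top[of 0] by eventually_elim auto
  then obtain k where "0 < k \<and> expectation (\<lambda>\<omega>. (Z \<omega>)\<^sup>2) - e / 2 < expectation (\<lambda>\<omega>. ?c k (Z \<omega>))"
    using eventually_happens'[OF sequentially_bot] by blast
  then have k: "0 < k" "expectation (\<lambda>\<omega>. (Z \<omega>)\<^sup>2) - expectation (\<lambda>\<omega>. ?c k (Z \<omega>)) < e / 2"
    by simp_all
  have "continuous_on UNIV (?c k)" by (intro continuous_intros)
  moreover have "\<bar>?c k z\<bar> \<le> (real k)\<^sup>2" for z by auto
  ultimately have "(\<lambda>m. measure_pmf.expectation (P m) (\<lambda>x. ?c k (g m x))) \<longlonglongrightarrow> expectation (\<lambda>\<omega>. ?c k (Z \<omega>))"
    by (rule bounded_continuous_lim)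
  then have "\<forall>\<^sub>F m in sequentially. measure_pmf.expectation (P m) (\<lambda>x. (g m x)\<^sup>2) -
      measure_pmf.expectation (P m) (\<lambda>x. ?c k (g m x)) < e / 2"
    by (rule order_tendstoD(2)[OF tendsto_diff[OF Z_square_lim]]) (rule k(2))
  then have "\<forall>\<^sub>F m in sequentially.
      measure_pmf.expectation (P m) (\<lambda>x. of_bool (2 * real k < g m x) * (g m x)\<^sup>2) < e"
    using finite_support
  proof eventually_elim
    case (elim m)
    have int: "integrable (measure_pmf (P m)) h" for h :: "'c \<Rightarrow> real"
      using elim by (intro integrable_measure_pmf_finite)
    \<comment> \<open>The tail is cut at \<open>2 * k\<close> because just above \<open>k\<close>
      the excess \<open>z\<^sup>2 - k\<^sup>2\<close> is small compared with
      \<open>z\<^sup>2\<close>; beyond \<open>2 * k\<close> it is at least half of it.\<close>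
    have pt: "of_bool (2 * real k < z) * z\<^sup>2 \<le> 2 * (z\<^sup>2 - ?c k z)" for z :: real
    proof (cases "2 * real k < z")
      case True
      then have "(2 * real k)\<^sup>2 \<le> z\<^sup>2" by (intro power_mono) auto
      then have "4 * (real k)\<^sup>2 \<le> z\<^sup>2" by (simp add: power_mult_distrib)
      then have "2 * (real k)\<^sup>2 \<le> z\<^sup>2" using zero_le_power2[of "real k"] by linarith
      then have "z\<^sup>2 \<le> 2 * (z\<^sup>2 - (real k)\<^sup>2)" by simp
      also have "\<dots> \<le> 2 * (z\<^sup>2 - ?c k z)" by simp
      finally show ?thesis using True by simp
    qed auto
    have "measure_pmf.expectation (P m) (\<lambda>x. of_bool (2 * real k < g m x) * (g m x)\<^sup>2) \<le>
        measure_pmf.expectation (P m) (\<lambda>x. 2 * ((g m x)\<^sup>2 - ?c k (g m x)))"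
      by (intro integral_mono int pt)
    also have "\<dots> = 2 * (measure_pmf.expectation (P m) (\<lambda>x. (g m x)\<^sup>2) -
        measure_pmf.expectation (P m) (\<lambda>x. ?c k (g m x)))"
      using int by simp
    finally show ?case using elim by simp
  qed
  with k show ?thesis by (intro that[of "2 * real k"]) auto
qed

text \<open>The test function \<open>c\<close> is bounded, continuous, nonnegative and zero exactly
  on the nonnegative reals, so its expectation under the limit is a limit of zeros.\<close>

lemma limit_nonneg:
  assumes "\<And>m x. 0 \<le> g m x"
  shows "AE \<omega> in M. 0 \<le> Z \<omega>"
proof -
  define c where "c z = min 1 (max 0 (- z))" for z :: real
  have c_cont: "continuous_on UNIV c" unfolding c_def by (intro continuous_intros)
  have c_bdd: "\<bar>c z\<bar> \<le> 1" for z by (auto simp: c_def)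
  have [measurable]: "c \<in> borel_measurable borel"
    using c_cont by (rule borel_measurable_continuous_onI)
  have "c (g m x) = 0" for m x using assms[of m x] by (simp add: c_def)
  then have "(\<lambda>m. 0) \<longlonglongrightarrow> expectation (\<lambda>\<omega>. c (Z \<omega>))"
    using bounded_continuous_lim[OF c_cont c_bdd] by simp
  then have "expectation (\<lambda>\<omega>. c (Z \<omega>)) = 0"
    using LIMSEQ_unique tendsto_const by blast
  moreover have "integrable M (\<lambda>\<omega>. c (Z \<omega>))"
    by (rule integrable_const_bound[of _ 1]) (use c_bdd in auto)
  moreover have "AE \<omega> in M. 0 \<le> c (Z \<omega>)" by (simp add: c_def)
  ultimately have "AE \<omega> in M. c (Z \<omega>) = 0"
    by (simp add: integral_nonneg_eq_0_iff_AE)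
  then show ?thesis
    by eventually_elim (simp add: c_def min_def max_def split: if_splits)
qed

end

section \<open>Mixed Poisson distributions\<close>

text \<open>The factors \<open>k\<close> and \<open>k * (k - 1)\<close> cancel against the
  factorial, leaving the exponential series shifted by one or two places. The omitted initial terms
  are zero, so undoing the shift keeps the sum.\<close>

lemma poisson_mean: "(\<lambda>k. real k * ((t::real) ^ k / fact k * exp (- t))) sums t"
  and poisson_factorial_moment: "(\<lambda>k. real k * (real k - 1) * (t ^ k / fact k * exp (- t))) sums t\<^sup>2"
proof -
  have exp_cancel: "exp (- t) * exp t = 1"
    by (simp add: exp_minus)
  have e: "(\<lambda>k. t ^ k / fact k) sums exp t"
    using exp_converges[of t] by (simp add: divide_inverse mult.commute)
  have "(\<lambda>k. t * exp (- t) * (t ^ k / fact k)) sums (t * exp (- t) * exp t)"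
    by (rule sums_mult[OF e])
  moreover have "(\<lambda>k. t * exp (- t) * (t ^ k / fact k)) =
      (\<lambda>k. real (Suc k) * (t ^ Suc k / fact (Suc k) * exp (- t)))"
    by (intro ext) (simp del: of_nat_Suc)
  ultimately have "(\<lambda>k. real (Suc k) * (t ^ Suc k / fact (Suc k) * exp (- t))) sums t"
    by (simp only: mult.assoc[of _ "exp (- t)" "exp t"] exp_cancel mult_1_right)
  then show "(\<lambda>k. real k * (t ^ k / fact k * exp (- t))) sums t"
    by (subst (asm) sums_Suc_iff) simp
  have pred: "real (Suc (Suc k)) - 1 = real (Suc k)" for k
    by simp
  have "(\<lambda>k. t\<^sup>2 * exp (- t) * (t ^ k / fact k)) sums (t\<^sup>2 * exp (- t) * exp t)"
    by (rule sums_mult[OF e])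
  moreover have "(\<lambda>k. t\<^sup>2 * exp (- t) * (t ^ k / fact k)) =
      (\<lambda>k. real (Suc (Suc k)) * (real (Suc (Suc k)) - 1) * (t ^ Suc (Suc k) / fact (Suc (Suc k)) * exp (- t)))"
    unfolding pred by (intro ext) (simp add: power2_eq_square del: of_nat_Suc)
  ultimately have "(\<lambda>k. real (Suc (Suc k)) * (real (Suc (Suc k)) - 1) *
      (t ^ Suc (Suc k) / fact (Suc (Suc k)) * exp (- t))) sums t\<^sup>2"
    by (simp only: mult.assoc[of _ "exp (- t)" "exp t"] exp_cancel mult_1_right)
  then have "(\<lambda>k. real (Suc k) * (real (Suc k) - 1) * (t ^ Suc k / fact (Suc k) * exp (- t))) sums t\<^sup>2"
    by (subst (asm) sums_Suc_iff) simp
  then show "(\<lambda>k. real k * (real k - 1) * (t ^ k / fact k * exp (- t))) sums t\<^sup>2"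
    by (subst (asm) sums_Suc_iff) simp
qed

lemma nn_integral_nat_valued:
  fixes d :: "'b \<Rightarrow> nat" and h :: "nat \<Rightarrow> ennreal"
  assumes "d \<in> measurable N (count_space UNIV)"
  shows "(\<integral>\<^sup>+\<omega>. h (d \<omega>) \<partial>N) = (\<Sum>k. h k * emeasure N {\<omega> \<in> space N. d \<omega> = k})"
proof -
  have [measurable]: "d \<in> measurable N (count_space UNIV)" by fact
  have "(\<integral>\<^sup>+\<omega>. h (d \<omega>) \<partial>N) = (\<integral>\<^sup>+\<omega>. (\<Sum>k. h k * indicator {\<omega> \<in> space N. d \<omega> = k} \<omega>) \<partial>N)"
  proof (rule nn_integral_cong)
    fix \<omega> assume "\<omega> \<in> space N"
    then have "h k * indicator {\<omega> \<in> space N. d \<omega> = k} \<omega> = (if k = d \<omega> then h k else 0)" for k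
      by (auto simp: indicator_def)
    then have "(\<lambda>k. h k * indicator {\<omega> \<in> space N. d \<omega> = k} \<omega>) sums h (d \<omega>)"
      using sums_single[of "d \<omega>" h] by simp
    then show "h (d \<omega>) = (\<Sum>k. h k * indicator {\<omega> \<in> space N. d \<omega> = k} \<omega>)"
      by (rule sums_unique)
  qed
  also have "\<dots> = (\<Sum>k. h k * emeasure N {\<omega> \<in> space N. d \<omega> = k})"
    by (subst nn_integral_suminf) (auto intro!: suminf_cong nn_integral_cmult_indicator)
  finally show ?thesis .
qed

text \<open>Conditionally on \<open>T\<close> the variable \<open>d\<close> is Poisson, and
  \<open>H t\<close> is the mean of \<open>h\<close> under the Poisson law with parameter
  \<open>t\<close>. The exchange of sum and expectation is Tonelli's theorem in
  \<open>ennreal\<close>; finiteness of the result, from \<open>H_int\<close>, then gives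
  integrability of \<open>h\<close> along \<open>d\<close>.\<close>

lemma mixed_poisson_integral:
  fixes h :: "nat \<Rightarrow> real" and H :: "real \<Rightarrow> real"
  assumes "prob_space M" "prob_space N"
    and d: "d \<in> measurable N (count_space UNIV)"
    and T [measurable]: "T \<in> borel_measurable M" and T_nonneg: "AE \<omega> in M. 0 \<le> T \<omega>"
    and d_distr: "\<And>k. measure N {\<omega> \<in> space N. d \<omega> = k} =
        prob_space.expectation M (\<lambda>\<omega>. T \<omega> ^ k / fact k * exp (- T \<omega>))"
    and h: "\<And>k. 0 \<le> h k"
    and H: "\<And>t. 0 \<le> t \<Longrightarrow> (\<lambda>k. h k * (t ^ k / fact k * exp (- t))) sums H t"
    and H_int: "integrable M (\<lambda>\<omega>. H (T \<omega>))"
  shows "integrable N (\<lambda>\<omega>. h (d \<omega>))"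
    and "prob_space.expectation N (\<lambda>\<omega>. h (d \<omega>)) = prob_space.expectation M (\<lambda>\<omega>. H (T \<omega>))"
proof -
  interpret M: prob_space M by fact
  interpret N: prob_space N by fact
  note [measurable] = d
  define q where "q k t = t ^ k / fact k * exp (- t)" for k and t :: real
  \<comment> \<open>A Poisson weight is at most 1, being one term of the exponential series times
    \<open>exp (- t)\<close>. Boundedness makes the weights integrable, so \<open>d_distr\<close>
    can be restated with nonnegative integrals.\<close>
  have q_le: "q k t \<le> 1" "0 \<le> q k t" if "0 \<le> t" for k t
  proof -
    show "0 \<le> q k t" using that by (simp add: q_def)
    have "t ^ k / fact k \<le> exp t"
      using that sum_le_suminf[OF summable_exp_generic[of t], of "{k}"]
      by (simp add: exp_def divide_inverse mult.commute)
    then have "t ^ k / fact k * exp (- t) \<le> exp t * exp (- t)" by (intro mult_right_mono) auto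
    then show "q k t \<le> 1" by (simp add: q_def exp_minus)
  qed
  have [measurable]: "(\<lambda>\<omega>. q k (T \<omega>)) \<in> borel_measurable M" for k
    unfolding q_def by measurable
  have emeasure_d: "emeasure N {\<omega> \<in> space N. d \<omega> = k} = (\<integral>\<^sup>+\<omega>. q k (T \<omega>) \<partial>M)" for k
  proof -
    have "integrable M (\<lambda>\<omega>. q k (T \<omega>))"
      by (rule M.integrable_const_bound[of _ 1]) (use T_nonneg q_le in \<open>auto elim!: eventually_mono\<close>)
    then have "(\<integral>\<^sup>+\<omega>. q k (T \<omega>) \<partial>M) = ennreal (M.expectation (\<lambda>\<omega>. q k (T \<omega>)))"
      by (rule nn_integral_eq_integral) (use T_nonneg q_le in \<open>auto elim!: eventually_mono\<close>)
    then show ?thesis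
      using d_distr[of k] by (simp add: N.emeasure_eq_measure q_def)
  qed
  have H_nonneg: "0 \<le> H t" if "0 \<le> t" for t
    using sums_le[OF _ sums_zero H[OF that]] h that by simp
  have "(\<integral>\<^sup>+\<omega>. h (d \<omega>) \<partial>N) = (\<Sum>k. ennreal (h k) * (\<integral>\<^sup>+\<omega>. q k (T \<omega>) \<partial>M))"
    using nn_integral_nat_valued[OF d, of "\<lambda>k. ennreal (h k)"] by (simp add: emeasure_d)
  also have "\<dots> = (\<integral>\<^sup>+\<omega>. (\<Sum>k. ennreal (h k) * ennreal (q k (T \<omega>))) \<partial>M)"
    by (subst nn_integral_suminf) (auto simp: nn_integral_cmult)
  also have "\<dots> = (\<integral>\<^sup>+\<omega>. H (T \<omega>) \<partial>M)"
  proof (rule nn_integral_cong_AE, use T_nonneg in eventually_elim)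
    fix \<omega> assume t: "0 \<le> T \<omega>"
    have sums: "(\<lambda>k. h k * q k (T \<omega>)) sums H (T \<omega>)"
      using H[OF t] by (simp add: q_def)
    have "(\<Sum>k. ennreal (h k) * ennreal (q k (T \<omega>))) = (\<Sum>k. ennreal (h k * q k (T \<omega>)))"
      using h q_le[OF t] by (simp add: ennreal_mult)
    also have "\<dots> = ennreal (\<Sum>k. h k * q k (T \<omega>))"
      using h q_le[OF t] by (intro suminf_ennreal2 sums_summable[OF sums]) simp
    also have "\<dots> = ennreal (H (T \<omega>))"
      using sums by (simp add: sums_iff)
    finally show "(\<Sum>k. ennreal (h k) * ennreal (q k (T \<omega>))) = ennreal (H (T \<omega>))" .
  qed
  also have "\<dots> = ennreal (M.expectation (\<lambda>\<omega>. H (T \<omega>)))"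
    by (rule nn_integral_eq_integral[OF H_int]) (use T_nonneg H_nonneg in \<open>auto elim!: eventually_mono\<close>)
  finally have *: "(\<integral>\<^sup>+\<omega>. h (d \<omega>) \<partial>N) = ennreal (M.expectation (\<lambda>\<omega>. H (T \<omega>)))" .
  have "0 \<le> M.expectation (\<lambda>\<omega>. H (T \<omega>))"
    by (rule integral_nonneg_AE) (use T_nonneg H_nonneg in \<open>auto elim!: eventually_mono\<close>)
  then have "has_bochner_integral N (\<lambda>\<omega>. h (d \<omega>)) (M.expectation (\<lambda>\<omega>. H (T \<omega>)))"
    using * h by (intro has_bochner_integral_nn_integral) auto
  then show "integrable N (\<lambda>\<omega>. h (d \<omega>))"
    "N.expectation (\<lambda>\<omega>. h (d \<omega>)) = M.expectation (\<lambda>\<omega>. H (T \<omega>))"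
    by (auto simp: has_bochner_integral_iff)
qed

section \<open>The limit of the clustering coefficient\<close>

text \<open>The null sequence \<open>r\<close> may depend on \<open>e\<close>. This fits truncation:
  the level is fixed first to make the tail at most \<open>e\<close>, and only then does
  \<open>m\<close> tend to infinity with constants depending on that level.\<close>

lemma tendsto_truncation:
  fixes x y :: "nat \<Rightarrow> real"
  assumes y: "y \<longlonglongrightarrow> l"
    and approx: "\<And>e. 0 < e \<Longrightarrow> \<exists>r. r \<longlonglongrightarrow> 0 \<and> (\<forall>\<^sub>F m in sequentially. \<bar>x m - y m\<bar> \<le> e + r m)"
  shows "x \<longlonglongrightarrow> l"
proof (rule tendstoI)
  fix e :: real assume e: "0 < e"
  then obtain r where r: "r \<longlonglongrightarrow> 0" and le: "\<forall>\<^sub>F m in sequentially. \<bar>x m - y m\<bar> \<le> e / 3 + r m"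
    using approx[of "e / 3"] by auto
  have "\<forall>\<^sub>F m in sequentially. r m < e / 3" using r e by (intro order_tendstoD) auto
  moreover have "\<forall>\<^sub>F m in sequentially. dist (y m) l < e / 3" using y e by (intro tendstoD) auto
  ultimately show "\<forall>\<^sub>F m in sequentially. dist (x m) l < e"
    using le by eventually_elim (unfold dist_real_def, linarith)
qed

text \<open>Scaled by \<open>N m ^ 2\<close>, the triangle probability tends to
  \<open>l1 ^ 3\<close> and the path probability to \<open>l2 * l1\<^sup>2\<close>; the scaling
  cancels in the quotient.\<close>

lemma clustering_coefficient_limit:
  fixes n s :: "nat \<Rightarrow> nat" and P :: "nat \<Rightarrow> nat pmf"
  defines "A1 \<equiv> \<lambda>m. measure_pmf.expectation (P m) (\<lambda>x. real (x choose s m))"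
    and "A2 \<equiv> \<lambda>m. measure_pmf.expectation (P m) (\<lambda>x. real (x choose s m) ^ 2)"
    and "tail \<equiv> \<lambda>L m. measure_pmf.expectation (P m) (\<lambda>x. (1 - of_bool (x \<le> L)) * real (x choose s m) ^ 2)"
  assumes n_ge: "\<forall>\<^sub>F m in sequentially. 3 \<le> n m"
    and s_range: "\<forall>\<^sub>F m in sequentially. 1 \<le> s m \<and> s m \<le> S"
    and P_range: "\<forall>\<^sub>F m in sequentially. set_pmf (P m) \<subseteq> {0..m}"
    and A1: "A1 \<longlonglongrightarrow> l1" and A2: "A2 \<longlonglongrightarrow> l2" and l1: "0 < l1" and l2: "0 < l2"
    and tail: "\<And>e. 0 < e \<Longrightarrow> \<exists>L. \<forall>\<^sub>F m in sequentially. tail L m \<le> e"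
  shows "(\<lambda>m. clustering_coefficient (s m) (n m) m (P m)) \<longlonglongrightarrow> l1 / l2"
proof -
  define N where "N m = real (m choose s m)" for m
  define \<rho> where "\<rho> m = real (Suc (s m)) / real (m - s m)" for m
  define pp where "pp m = path_probability (s m) m (P m) * N m ^ 2" for m
  define tt where "tt m = triangle_probability (s m) m (P m) * N m ^ 2" for m
  have model: "\<forall>\<^sub>F m in sequentially. random_intersection_triple m (P m) (s m) \<and> s m \<le> S"
    using s_range P_range eventually_gt_at_top[of S]
    by eventually_elim (auto simp: random_intersection_triple_def random_subset_model_def
      random_intersection_triple_axioms_def)
  have \<rho>_lim: "\<rho> \<longlonglongrightarrow> 0"
  proof (rule tendsto_sandwich[where f = "\<lambda>_. 0" and h = "\<lambda>m. real (Suc S) / (- real S + real m)"])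
    show "\<forall>\<^sub>F m in sequentially. \<rho> m \<le> real (Suc S) / (- real S + real m)"
      using s_range eventually_gt_at_top[of S]
      by eventually_elim (auto simp: \<rho>_def of_nat_diff intro!: frac_le)
    have "filterlim (\<lambda>m. - real S + real m) at_top sequentially"
      by (rule filterlim_tendsto_add_at_top[OF tendsto_const filterlim_real_sequentially])
    then show "(\<lambda>m. real (Suc S) / (- real S + real m)) \<longlonglongrightarrow> 0"
      by (intro tendsto_divide_0[OF tendsto_const] filterlim_at_top_imp_at_infinity)
  qed (auto simp: \<rho>_def)
  \<comment> \<open>\<open>C\<close> eventually bounds both moments, so the coefficients of the tail
    in \<open>path_bounds\<close> and \<open>triangle_bounds\<close> are both at most
    \<open>3 * C\<^sup>2\<close>.\<close>
  define C where "C = l1 + l2 + 1"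
  have C: "1 \<le> C" using l1 l2 by (simp add: C_def)
  have le_C: "\<forall>\<^sub>F m in sequentially. A1 m \<le> C \<and> A2 m \<le> C"
  proof -
    have "\<forall>\<^sub>F m in sequentially. A1 m < C" "\<forall>\<^sub>F m in sequentially. A2 m < C"
      using l1 l2 by (auto simp: C_def intro!: order_tendstoD(2)[OF A1] order_tendstoD(2)[OF A2])
    then show ?thesis by eventually_elim simp
  qed
  have nonneg: "0 \<le> A1 m" "0 \<le> A2 m" "0 \<le> tail L m" for m L
    unfolding A1_def A2_def tail_def by (auto intro!: integral_nonneg_AE)
  have tail': "\<exists>L. \<forall>\<^sub>F m in sequentially. 3 * C\<^sup>2 * tail L m \<le> e" if "0 < e" for e
  proof -
    have "0 < e / (3 * C\<^sup>2)"
      using that C by (intro divide_pos_pos mult_pos_pos zero_less_power) auto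
    then obtain L where "\<forall>\<^sub>F m in sequentially. tail L m \<le> e / (3 * C\<^sup>2)"
      using tail by blast
    then have "\<forall>\<^sub>F m in sequentially. 3 * C\<^sup>2 * tail L m \<le> e"
      by eventually_elim (use C in \<open>simp add: field_simps\<close>)
    then show ?thesis ..
  qed
  have "pp \<longlonglongrightarrow> l2 * l1\<^sup>2"
  proof (rule tendsto_truncation)
    show "(\<lambda>m. A2 m * (A1 m)\<^sup>2) \<longlonglongrightarrow> l2 * l1\<^sup>2"
      by (intro tendsto_intros A1 A2)
    fix e :: real assume "0 < e"
    then obtain L where L: "\<forall>\<^sub>F m in sequentially. 3 * C\<^sup>2 * tail L m \<le> e" using tail' by blast
    let ?r = "\<lambda>m. 2 * real S * 2 ^ (4 * L) * \<rho> m"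
    have "?r \<longlonglongrightarrow> 0" by (intro tendsto_mult_right_zero \<rho>_lim)
    moreover have "\<forall>\<^sub>F m in sequentially. \<bar>pp m - A2 m * (A1 m)\<^sup>2\<bar> \<le> e + ?r m"
      using model L le_C
    proof eventually_elim
      case (elim m)
      interpret random_intersection_triple m "P m" "s m" L using elim by simp
      have "\<bar>pp m - A2 m * (A1 m)\<^sup>2\<bar> \<le>
          ((A1 m)\<^sup>2 + 2 * A1 m * A2 m) * tail L m + 2 * real (s m) * 2 ^ (4 * L) * \<rho> m"
        using path_bounds unfolding binomial_ratio pp_def N_def A1_def A2_def tail_def \<rho>_def .
      also have "((A1 m)\<^sup>2 + 2 * A1 m * A2 m) * tail L m \<le> (C\<^sup>2 + 2 * C * C) * tail L m"
        using elim nonneg C by (intro mult_right_mono add_mono power_mono mult_mono) auto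
      also have "(C\<^sup>2 + 2 * C * C) * tail L m = 3 * C\<^sup>2 * tail L m"
        by (simp add: power2_eq_square)
      also have "2 * real (s m) * 2 ^ (4 * L) * \<rho> m \<le> ?r m"
        using elim by (intro mult_right_mono mult_left_mono) (auto simp: \<rho>_def)
      finally show ?case using elim by simp
    qed
    ultimately show "\<exists>r. r \<longlonglongrightarrow> 0 \<and> (\<forall>\<^sub>F m in sequentially. \<bar>pp m - A2 m * (A1 m)\<^sup>2\<bar> \<le> e + r m)"
      by blast
  qed
  moreover have "tt \<longlonglongrightarrow> l1 ^ 3"
  proof (rule tendsto_truncation)
    show "(\<lambda>m. A1 m ^ 3) \<longlonglongrightarrow> l1 ^ 3"
      by (intro tendsto_intros A1)
    fix e :: real assume "0 < e"
    then obtain L where L: "\<forall>\<^sub>F m in sequentially. 3 * C\<^sup>2 * tail L m \<le> e" using tail' by blast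
    let ?r = "\<lambda>m. real S * 2 ^ (3 * L) * (\<rho> m)\<^sup>2 + 2 ^ (5 * L) * \<rho> m"
    have "?r \<longlonglongrightarrow> 0"
      using \<rho>_lim by (auto intro!: tendsto_eq_intros)
    moreover have "\<forall>\<^sub>F m in sequentially. \<bar>tt m - A1 m ^ 3\<bar> \<le> e + ?r m"
      using model L le_C
    proof eventually_elim
      case (elim m)
      interpret random_intersection_triple m "P m" "s m" L using elim by simp
      have "\<bar>tt m - A1 m ^ 3\<bar> \<le> 3 * (A1 m)\<^sup>2 * tail L m +
          (real (s m) * 2 ^ (3 * L) * (\<rho> m)\<^sup>2 + 2 ^ (5 * L) * \<rho> m)"
        using triangle_bounds unfolding binomial_ratio tt_def N_def A1_def A2_def tail_def \<rho>_def .
      also have "3 * (A1 m)\<^sup>2 * tail L m \<le> 3 * C\<^sup>2 * tail L m"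
        using elim nonneg C by (intro mult_right_mono mult_left_mono power_mono) auto
      also have "real (s m) * 2 ^ (3 * L) * (\<rho> m)\<^sup>2 \<le> real S * 2 ^ (3 * L) * (\<rho> m)\<^sup>2"
        using elim by (intro mult_right_mono) auto
      finally show ?case using elim by simp
    qed
    ultimately show "\<exists>r. r \<longlonglongrightarrow> 0 \<and> (\<forall>\<^sub>F m in sequentially. \<bar>tt m - A1 m ^ 3\<bar> \<le> e + r m)"
      by blast
  qed
  ultimately have "(\<lambda>m. tt m / pp m) \<longlonglongrightarrow> l1 ^ 3 / (l2 * l1\<^sup>2)"
    using l1 l2 by (intro tendsto_divide) auto
  also have "l1 ^ 3 / (l2 * l1\<^sup>2) = l1 / l2"
    using l1 l2 by (simp add: power3_eq_cube power2_eq_square)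
  finally have "(\<lambda>m. tt m / pp m) \<longlonglongrightarrow> l1 / l2" .
  moreover have "\<forall>\<^sub>F m in sequentially. tt m / pp m = clustering_coefficient (s m) (n m) m (P m)"
    using model n_ge
  proof eventually_elim
    case (elim m)
    \<comment> \<open>The exact quotient does not contain the truncation level; \<open>0\<close> is
      a placeholder.\<close>
    interpret random_intersection_triple m "P m" "s m" 0 using elim by simp
    show ?case
      using N_pos elim by (simp add: tt_def pp_def N_def clustering_coefficient_eq
        path_probability_def triangle_probability_def)
  qed
  ultimately show ?thesis by (rule Lim_transform_eventually)
qed

lemma scaled_size_mult:
  assumes "0 < m choose s" "0 < n"
  shows "scaled_size s n m x * sqrt (real (m choose s) / real n) = real (x choose s)"
proof -
  have "real (m choose s) powr (- 1 / 2) = 1 / sqrt (real (m choose s))"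
    using powr_minus_divide[of "real (m choose s)" "1 / 2"] by (simp add: powr_half_sqrt)
  then show ?thesis
    using assms by (simp add: scaled_size_def powr_half_sqrt real_sqrt_divide)
qed

theorem corollary1:
  fixes \<beta> \<mu> :: real
    and n s :: "nat \<Rightarrow> nat"
    and P :: "nat \<Rightarrow> nat pmf"
    and M :: "'a measure" and Z :: "'a \<Rightarrow> real"
    and N :: "'b measure" and d :: "'b \<Rightarrow> nat"
  assumes beta: "\<beta> > 0"
    and n_lim: "filterlim n at_top at_top"
    and s_range: "\<And>m. m \<ge> 1 \<Longrightarrow> 1 \<le> s m \<and> s m \<le> m"
    and P_range: "\<And>m. m \<ge> 1 \<Longrightarrow> set_pmf (P m) \<subseteq> {0..m}"
    and s_bounded: "(\<lambda>m. real (s m)) \<in> O(\<lambda>_. 1)"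
    and beta_lim: "(\<lambda>m. real (m choose s m) / real (n m)) \<longlonglongrightarrow> \<beta>"
    and M: "prob_space M" and Z: "Z \<in> borel_measurable M"
    and Z_conv: "weak_conv_m
                   (\<lambda>m. distr (measure_pmf (P m)) borel (scaled_size (s m) (n m) m))
                   (distr M borel Z)"
    and Z_sq_integrable: "integrable M (\<lambda>\<omega>. (Z \<omega>)\<^sup>2)"
    and Z_sq_pos: "0 < prob_space.expectation M (\<lambda>\<omega>. (Z \<omega>)\<^sup>2)"
    and Z_sq_lim: "(\<lambda>m. measure_pmf.expectation (P m) (\<lambda>x. (scaled_size (s m) (n m) m x)\<^sup>2))
                     \<longlonglongrightarrow> prob_space.expectation M (\<lambda>\<omega>. (Z \<omega>)\<^sup>2)"
    and mu: "\<mu> = prob_space.expectation M Z"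
    and N: "prob_space N" and d: "d \<in> measurable N (count_space UNIV)"
    and d_distr: "\<And>k. measure N {\<omega> \<in> space N. d \<omega> = k} =
        1 / fact k * prob_space.expectation M (\<lambda>\<omega>. (Z \<omega> * \<mu>) ^ k * exp (- (Z \<omega> * \<mu>)))"
  shows "(\<lambda>m. clustering_coefficient (s m) (n m) m (P m) -
            1 / sqrt \<beta> *
              (prob_space.expectation N (\<lambda>\<omega>. real (d \<omega>)) powr (3 / 2) /
               (prob_space.expectation N (\<lambda>\<omega>. (real (d \<omega>))\<^sup>2) -
                prob_space.expectation N (\<lambda>\<omega>. real (d \<omega>)))))
         \<in> o(\<lambda>_. 1)"
proof -
  interpret M: prob_space M by fact
  interpret N: prob_space N by fact
  let ?g = "\<lambda>m. scaled_size (s m) (n m) m"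
  have P_ev: "\<forall>\<^sub>F m in sequentially. set_pmf (P m) \<subseteq> {0..m}"
    using eventually_ge_at_top[of 1] by eventually_elim (rule P_range)
  interpret l2_weak_limit M Z P ?g
  proof
    show "\<forall>\<^sub>F m in sequentially. finite (set_pmf (P m))"
      using P_ev by eventually_elim (auto intro: finite_subset)
  qed (fact Z Z_conv Z_sq_integrable Z_sq_lim)+
  define V where "V = M.expectation (\<lambda>\<omega>. (Z \<omega>)\<^sup>2)"
  have V: "0 < V" using Z_sq_pos by (simp add: V_def)
  have Z_nonneg: "AE \<omega> in M. 0 \<le> Z \<omega>"
    by (rule limit_nonneg) (simp add: scaled_size_def)
  \<comment> \<open>A zero mean would force the nonnegative \<open>Z\<close> to vanish almost
    surely, against the positive second moment.\<close>
  have mu_pos: "0 < \<mu>"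
  proof -
    have "\<mu> \<noteq> 0"
    proof
      assume "\<mu> = 0"
      then have "AE \<omega> in M. Z \<omega> = 0"
        using mu Z_nonneg Z_integrable by (simp add: integral_nonneg_eq_0_iff_AE)
      then have "V = M.expectation (\<lambda>\<omega>. 0)"
        unfolding V_def using Z by (intro integral_cong_AE) (auto elim!: eventually_mono)
      then show False using V by simp
    qed
    moreover have "0 \<le> \<mu>" unfolding mu using Z_nonneg by (rule integral_nonneg_AE)
    ultimately show ?thesis by simp
  qed

  \<comment> \<open>Mean and second factorial moment of the mixed Poisson variable\<close>
  have T: "AE \<omega> in M. 0 \<le> Z \<omega> * \<mu>"
    using Z_nonneg by eventually_elim (use mu_pos in simp)
  have T_distr: "measure N {\<omega> \<in> space N. d \<omega> = k} =
      M.expectation (\<lambda>\<omega>. (Z \<omega> * \<mu>) ^ k / fact k * exp (- (Z \<omega> * \<mu>)))" for k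
    using d_distr[of k] by simp
  have T_meas: "(\<lambda>\<omega>. Z \<omega> * \<mu>) \<in> borel_measurable M" using Z by simp
  have d_mean: "integrable N (\<lambda>\<omega>. real (d \<omega>))" "N.expectation (\<lambda>\<omega>. real (d \<omega>)) = \<mu>\<^sup>2"
  proof -
    note * = mixed_poisson_integral[OF M N d T_meas T T_distr, of real "\<lambda>t. t"]
    have "integrable M (\<lambda>\<omega>. Z \<omega> * \<mu>)" using Z_integrable by simp
    then show "integrable N (\<lambda>\<omega>. real (d \<omega>))" "N.expectation (\<lambda>\<omega>. real (d \<omega>)) = \<mu>\<^sup>2"
      using * poisson_mean by (simp_all add: mu[symmetric] power2_eq_square)
  qed
  have d_fact: "N.expectation (\<lambda>\<omega>. (real (d \<omega>))\<^sup>2) - N.expectation (\<lambda>\<omega>. real (d \<omega>)) = \<mu>\<^sup>2 * V"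
  proof -
    \<comment> \<open>At \<open>k = 0\<close> the real factor \<open>k - 1\<close> is negative, but
      the product is zero.\<close>
    have nonneg: "0 \<le> real k * (real k - 1)" for k by (cases k) auto
    note * = mixed_poisson_integral[OF M N d T_meas T T_distr, of "\<lambda>k. real k * (real k - 1)" "\<lambda>t. t\<^sup>2"]
    have "integrable M (\<lambda>\<omega>. (Z \<omega> * \<mu>)\<^sup>2)" using Z_sq_integrable by (simp add: power_mult_distrib)
    then have fact_moment: "integrable N (\<lambda>\<omega>. real (d \<omega>) * (real (d \<omega>) - 1))"
      "N.expectation (\<lambda>\<omega>. real (d \<omega>) * (real (d \<omega>) - 1)) = M.expectation (\<lambda>\<omega>. (Z \<omega> * \<mu>)\<^sup>2)"
      using * nonneg poisson_factorial_moment by simp_all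
    have "N.expectation (\<lambda>\<omega>. (real (d \<omega>))\<^sup>2) =
        N.expectation (\<lambda>\<omega>. real (d \<omega>) * (real (d \<omega>) - 1) + real (d \<omega>))"
      by (intro Bochner_Integration.integral_cong) (simp_all add: algebra_simps power2_eq_square)
    also have "\<dots> = N.expectation (\<lambda>\<omega>. real (d \<omega>) * (real (d \<omega>) - 1)) + N.expectation (\<lambda>\<omega>. real (d \<omega>))"
      by (rule Bochner_Integration.integral_add[OF fact_moment(1) d_mean(1)])
    finally show ?thesis
      using fact_moment(2) by (simp add: V_def power_mult_distrib mult.commute)
  qed

  \<comment> \<open>Eventual bounds on the parameters and removal of the scaling\<close>
  obtain S where S: "\<forall>\<^sub>F m in sequentially. 1 \<le> s m \<and> s m \<le> S"
  proof -
    obtain c where "\<forall>\<^sub>F m in sequentially. norm (real (s m)) \<le> c * norm (1 :: real)"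
      using s_bounded by (rule landau_o.bigE)
    then have "\<forall>\<^sub>F m in sequentially. 1 \<le> s m \<and> s m \<le> nat \<lceil>c\<rceil>"
      using eventually_ge_at_top[of 1]
    proof eventually_elim
      case (elim m)
      then have "real (s m) \<le> c" by simp
      then have "s m \<le> nat \<lceil>c\<rceil>" by linarith
      then show ?case using s_range[OF elim(2)] by simp
    qed
    then show ?thesis by (rule that)
  qed
  have n_ge: "\<forall>\<^sub>F m in sequentially. 3 \<le> n m"
    using n_lim by (simp add: filterlim_at_top)
  define r where "r m = sqrt (real (m choose s m) / real (n m))" for m
  have r_lim: "r \<longlonglongrightarrow> sqrt \<beta>"
    unfolding r_def by (intro tendsto_real_sqrt beta_lim)
  have size_eq: "\<forall>\<^sub>F m in sequentially. 0 < r m \<and> (\<forall>x. real (x choose s m) = r m * ?g m x)"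
    using n_ge eventually_ge_at_top[of 1]
  proof eventually_elim
    case (elim m)
    then have "0 < m choose s m" "0 < n m" using s_range[of m] by auto
    then show ?case
      using scaled_size_mult[of m "s m" "n m"] by (simp add: r_def mult.commute)
  qed

  \<comment> \<open>Limit of the coefficient from the unscaled moments\<close>
  have "(\<lambda>m. clustering_coefficient (s m) (n m) m (P m)) \<longlonglongrightarrow> (sqrt \<beta> * \<mu>) / ((sqrt \<beta>)\<^sup>2 * V)"
  proof (rule clustering_coefficient_limit[OF n_ge S P_ev])
    show "(\<lambda>m. measure_pmf.expectation (P m) (\<lambda>x. real (x choose s m))) \<longlonglongrightarrow> sqrt \<beta> * \<mu>"
    proof (rule Lim_transform_eventually)
      show "(\<lambda>m. r m * measure_pmf.expectation (P m) (?g m)) \<longlonglongrightarrow> sqrt \<beta> * \<mu>"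
        unfolding mu by (intro tendsto_mult r_lim mean_lim)
      show "\<forall>\<^sub>F m in sequentially. r m * measure_pmf.expectation (P m) (?g m) =
          measure_pmf.expectation (P m) (\<lambda>x. real (x choose s m))"
        using size_eq by eventually_elim simp
    qed
    show "(\<lambda>m. measure_pmf.expectation (P m) (\<lambda>x. real (x choose s m) ^ 2)) \<longlonglongrightarrow> (sqrt \<beta>)\<^sup>2 * V"
    proof (rule Lim_transform_eventually)
      show "(\<lambda>m. (r m)\<^sup>2 * measure_pmf.expectation (P m) (\<lambda>x. (?g m x)\<^sup>2)) \<longlonglongrightarrow> (sqrt \<beta>)\<^sup>2 * V"
        unfolding V_def by (intro tendsto_mult tendsto_power r_lim Z_sq_lim)
      show "\<forall>\<^sub>F m in sequentially. (r m)\<^sup>2 * measure_pmf.expectation (P m) (\<lambda>x. (?g m x)\<^sup>2) =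
          measure_pmf.expectation (P m) (\<lambda>x. real (x choose s m) ^ 2)"
        using size_eq by eventually_elim (simp add: power_mult_distrib)
    qed
    show "0 < sqrt \<beta> * \<mu>" "0 < (sqrt \<beta>)\<^sup>2 * V" using beta mu_pos V by auto
    fix e :: real assume e: "0 < e"
    \<comment> \<open>\<open>R\<close> eventually bounds \<open>r m\<close>. The squared binomial is
      \<open>(r m)\<^sup>2\<close> times the squared scaled size, so the tail of the latter is asked
      to be below \<open>e / R\<^sup>2\<close>.\<close>
    define R where "R = sqrt \<beta> + 1"
    have R: "1 \<le> R" using beta by (simp add: R_def)
    have r_le: "\<forall>\<^sub>F m in sequentially. r m < R"
      by (rule order_tendstoD(2)[OF r_lim]) (simp add: R_def)
    have "0 < e / R\<^sup>2"
      using e R by (intro divide_pos_pos zero_less_power) auto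
    then obtain K where K: "0 < K" and
      K_tail: "\<forall>\<^sub>F m in sequentially. measure_pmf.expectation (P m) (\<lambda>x. of_bool (K < ?g m x) * (?g m x)\<^sup>2) < e / R\<^sup>2"
      by (rule square_tail_small)
    \<comment> \<open>For \<open>x > L\<close> the summand \<open>S\<close> ensures
      \<open>s m \<le> x\<close>, so that \<open>x choose s m\<close> is at least
      \<open>(x / s m) ^ s m\<close> and hence at least \<open>x / S\<close>. The other summand
      makes \<open>x / S\<close> exceed \<open>K * R\<close>, and \<open>r m < R\<close> then gives
      a scaled size above \<open>K\<close>.\<close>
    define L where "L = S + nat \<lceil>K * R * S\<rceil>"
    have "\<forall>\<^sub>F m in sequentially.
        measure_pmf.expectation (P m) (\<lambda>x. (1 - of_bool (x \<le> L)) * real (x choose s m) ^ 2) \<le> e"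
      using size_eq r_le K_tail S finite_support
    proof eventually_elim
      case (elim m)
      have int: "integrable (measure_pmf (P m)) h" for h :: "nat \<Rightarrow> real"
        using elim by (intro integrable_measure_pmf_finite)
      have large: "K < ?g m x" if x: "L < x" for x
      proof -
        have s: "1 \<le> s m" "s m \<le> S" "s m \<le> x" using elim x by (auto simp: L_def)
        have "K * R * S < x" using x unfolding L_def by linarith
        then have "K * R < x / S" using s by (simp add: field_simps)
        also have "\<dots> \<le> x / s m" using s by (intro divide_left_mono) auto
        also have "\<dots> \<le> (x / s m) ^ s m" using s by (intro self_le_power) auto
        also have "\<dots> \<le> real (x choose s m)" using s by (intro binomial_ge_n_over_k_pow_k)
        also have "\<dots> = r m * ?g m x" using elim by simp
        finally have "K * r m < r m * ?g m x"
          using elim K mult_left_mono[of "r m" R K] by linarith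
        then show ?thesis using elim by simp
      qed
      have "measure_pmf.expectation (P m) (\<lambda>x. (1 - of_bool (x \<le> L)) * real (x choose s m) ^ 2) \<le>
          measure_pmf.expectation (P m) (\<lambda>x. (r m)\<^sup>2 * (of_bool (K < ?g m x) * (?g m x)\<^sup>2))"
        using elim(1) large
        by (intro integral_mono int) (auto simp: power_mult_distrib not_le)
      also have "\<dots> = (r m)\<^sup>2 * measure_pmf.expectation (P m) (\<lambda>x. of_bool (K < ?g m x) * (?g m x)\<^sup>2)"
        by (rule integral_mult_right_zero)
      also have "\<dots> \<le> R\<^sup>2 * (e / R\<^sup>2)"
        using elim by (intro mult_mono power_mono) (auto intro!: integral_nonneg_AE)
      also have "\<dots> = e" using R by simp
      finally show ?case .
    qed
    then show "\<exists>L. \<forall>\<^sub>F m in sequentially.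
        measure_pmf.expectation (P m) (\<lambda>x. (1 - of_bool (x \<le> L)) * real (x choose s m) ^ 2) \<le> e" ..
  qed
  also have "(sqrt \<beta> * \<mu>) / ((sqrt \<beta>)\<^sup>2 * V) = 1 / sqrt \<beta> * ((\<mu>\<^sup>2) powr (3 / 2) / (\<mu>\<^sup>2 * V))"
  proof -
    \<comment> \<open>Positivity of \<open>\<mu>\<close> is what makes this \<open>\<mu> ^ 3\<close>
      rather than the cube of the absolute value.\<close>
    have "(\<mu>\<^sup>2) powr (3 / 2) = \<mu> ^ 3"
      using mu_pos powr_powr[of \<mu> 2 "3 / 2"] powr_realpow[of \<mu> 2] powr_realpow[of \<mu> 3] by simp
    then show ?thesis
      using mu_pos V beta by (simp add: field_simps power2_eq_square power3_eq_cube)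
  qed
  finally have "(\<lambda>m. clustering_coefficient (s m) (n m) m (P m) -
      1 / sqrt \<beta> * ((\<mu>\<^sup>2) powr (3 / 2) / (\<mu>\<^sup>2 * V))) \<longlonglongrightarrow> 0"
    by (simp add: LIM_zero_iff)
  then show ?thesis
    unfolding d_fact unfolding d_mean(2) by (intro smalloI_tendsto) auto
qed

end
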